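(* Let $\Bbbk$ be an algebraically closed field, $n$ a positive integer, and $A=\Bbbk Q_n$ the path algebra of the quiver $Q_n\colon 1\xrightarrow{\alpha_1}2\xrightarrow{\alpha_2}\cdots\xrightarrow{\alpha_{n-1}}n$. Let $M=(\Bbbk^{a_1}\xrightarrow{M_1}\Bbbk^{a_2}\xrightarrow{M_2}\cdots\xrightarrow{M_{n-1}}\Bbbk^{a_n})$ be a finite-dimensional representation of $Q_n$, and set $M_0:=0$ and $M_n:=0$. Then for all integers $1\le b\le d\le n$, $$\boldsymbol{d}_M(\mathbb{I}(b,d))=\begin{cases}\operatorname{rank}(M_d\cdots M_{b-1})+\operatorname{rank}(M_{d-1}\cdots M_b)-\operatorname{rank}(M_{d-1}\cdots M_{b-1})-\operatorname{rank}(M_d\cdots M_b)&(b<d)\\ \operatorname{rank}(M_dM_{d-1})+a_b-\operatorname{rank}(M_{d-1})-\operatorname{rank}(M_d)&(b=d).\end{cases}$$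
   Context: Finite-dimensional $A$-modules are identified with finite-dimensional representations of $Q_n$ over $\Bbbk$; the $M_i\colon\Bbbk^{a_i}\to\Bbbk^{a_{i+1}}$ are linear maps (matrices), and $M_0$, $M_n$ are zero maps into $\Bbbk^{a_1}$ and out of $\Bbbk^{a_n}$ respectively (so any product containing them has rank $0$). Products $M_j\cdots M_i$ denote compositions $M_jM_{j-1}\cdots M_i$ for $j\ge i$. For $1\le b\le d\le n$, $\mathbb{I}(b,d)$ is the representation with $\Bbbk$ at each vertex $i$ with $b\le i\le d$, $0$ at the other vertices, identity maps between consecutive copies of $\Bbbk$, and zero maps elsewhere. The set $\mathcal{L}=\{\mathbb{I}(b,d)\mid1\le b\le d\le n\}$ is a complete set of representatives of isoclasses of indecomposable $A$-modules, and $\boldsymbol{d}_M\colon\mathcal{L}\to\mathbb{N}_0$ is the unique map with $M\cong\bigoplus_{L\in\mathcal{L}}L^{(\boldsymbol{d}_M(L))}$. *)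

theory Defs
  imports
    "HOL-Computational_Algebra.Polynomial"
    "Jordan_Normal_Form.DL_Rank"
begin

text \<open>
  Representations of the linearly oriented quiver \<open>1 \<rightarrow> 2 \<rightarrow> \<dots> \<rightarrow> n\<close> on coordinate spaces.
  The matrix attached to the arrow \<open>i \<rightarrow> i + 1\<close> acts on column vectors, so it has
  \<open>vdim V (Suc i)\<close> rows and \<open>vdim V i\<close> columns. Only the vertices \<open>1, \<dots>, n\<close> and the
  arrows \<open>1, \<dots>, n - 1\<close> are part of the representation; the other values of the two
  fields are ignored.
\<close>

record 'k quiver_rep =
  vdim :: "nat \<Rightarrow> nat"
  arrow :: "nat \<Rightarrow> 'k mat"

definition is_rep :: "nat \<Rightarrow> 'k quiver_rep \<Rightarrow> bool" where
  "is_rep n V \<longleftrightarrow> (\<forall>i\<in>{1..<n}. arrow V i \<in> carrier_mat (vdim V (Suc i)) (vdim V i))"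

definition rep_hom ::
  "nat \<Rightarrow> 'k::field quiver_rep \<Rightarrow> 'k quiver_rep \<Rightarrow> (nat \<Rightarrow> 'k mat) \<Rightarrow> bool" where
  "rep_hom n V W f \<longleftrightarrow>
     (\<forall>i\<in>{1..n}. f i \<in> carrier_mat (vdim W i) (vdim V i)) \<and>
     (\<forall>i\<in>{1..<n}. f (Suc i) * arrow V i = arrow W i * f i)"

definition rep_iso :: "nat \<Rightarrow> 'k::field quiver_rep \<Rightarrow> 'k quiver_rep \<Rightarrow> bool" where
  "rep_iso n V W \<longleftrightarrow>
     (\<exists>f g. rep_hom n V W f \<and> rep_hom n W V g \<and>
        (\<forall>i\<in>{1..n}. g i * f i = 1\<^sub>m (vdim V i) \<and> f i * g i = 1\<^sub>m (vdim W i)))"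

definition direct_sum_rep :: "'k::field quiver_rep list \<Rightarrow> 'k quiver_rep" where
  "direct_sum_rep Vs =
     \<lparr> vdim = (\<lambda>i. \<Sum>V\<leftarrow>Vs. vdim V i),
       arrow = (\<lambda>i. diag_block_mat (map (\<lambda>V. arrow V i) Vs)) \<rparr>"

definition interval_dim :: "nat \<Rightarrow> nat \<Rightarrow> nat \<Rightarrow> nat" where
  "interval_dim b d i = (if b \<le> i \<and> i \<le> d then 1 else 0)"

definition interval_rep :: "nat \<Rightarrow> nat \<Rightarrow> 'k::field quiver_rep" where
  "interval_rep b d =
     \<lparr> vdim = interval_dim b d,
       arrow = (\<lambda>i. if b \<le> i \<and> Suc i \<le> d then 1\<^sub>m 1
                    else 0\<^sub>m (interval_dim b d (Suc i)) (interval_dim b d i)) \<rparr>"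

definition interval_reps :: "nat \<Rightarrow> 'k::field quiver_rep set" where
  "interval_reps n = {interval_rep b d | b d. 1 \<le> b \<and> b \<le> d \<and> d \<le> n}"

definition interval_sum :: "nat \<Rightarrow> ('k::field quiver_rep \<Rightarrow> nat) \<Rightarrow> 'k quiver_rep" where
  "interval_sum n m =
     direct_sum_rep
       (concat [replicate (m (interval_rep b d)) (interval_rep b d).
                  b \<leftarrow> [1..<Suc n], d \<leftarrow> [b..<Suc n]])"

text \<open>
  The multiplicity function has domain \<open>interval_reps n\<close>; as a total HOL function it is
  normalised to \<open>0\<close> elsewhere, which is what makes it unique.
\<close>

definition multiplicity_fun :: "nat \<Rightarrow> 'k::field quiver_rep \<Rightarrow> 'k quiver_rep \<Rightarrow> nat" where
  "multiplicity_fun n V =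
     (THE m. (\<forall>L. L \<notin> interval_reps n \<longrightarrow> m L = 0) \<and> rep_iso n V (interval_sum n m))"

text \<open>
  \<open>composite M j i\<close> is the product \<open>M\<^sub>j M\<^sub>j\<^sub>-\<^sub>1 \<dots> M\<^sub>i\<close>; it is meaningful for \<open>i \<le> j\<close> only.
\<close>

primrec composite :: "(nat \<Rightarrow> 'k::field mat) \<Rightarrow> nat \<Rightarrow> nat \<Rightarrow> 'k mat" where
  "composite M 0 i = M 0"
| "composite M (Suc j) i = (if i \<le> j then M (Suc j) * composite M j i else M (Suc j))"

definition mat_rank :: "'k::field mat \<Rightarrow> nat" where
  "mat_rank A = vec_space.rank (dim_row A) A"

end

theory Submission
  imports Defs
begin

text \<open>
  Existence of the interval decomposition: let \<open>b\<close> be the first vertex with a nonzero space and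
  \<open>d\<close> the last vertex such that the path map from \<open>b\<close> to \<open>d\<close> is nonzero. A vector at \<open>b\<close> with
  nonzero image at \<open>d\<close> and a functional detecting that image give maps \<open>\<I>(b,d) \<rightarrow> V \<rightarrow> \<I>(b,d)\<close>
  with composite the identity, so \<open>\<I>(b,d)\<close> splits off, and one inducts on the total dimension.

  The formula, and with it uniqueness of the multiplicities: the rank of the path map from \<open>i\<close> to
  \<open>e\<close> counts the intervals containing both \<open>i\<close> and \<open>e\<close>. For \<open>b \<le> d\<close> the number of those equal
  to \<open>[b,d]\<close> is recovered by inclusion-exclusion over the corners \<open>(b,d)\<close>, \<open>(b-1,d)\<close>, \<open>(b,d+1)\<close>
  and \<open>(b-1,d+1)\<close>; the zero maps \<open>M\<^sub>0\<close> and \<open>M\<^sub>n\<close> account for corners outside the quiver.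
\<close>

section \<open>Rank factorisations\<close>

text \<open>Stated with dimension equations instead of carriers, so that \<open>simp\<close> can
  reassociate products without guessing intermediate dimensions.\<close>

lemma mult_assoc_dim:
  fixes A B C :: "'a::semiring_0 mat"
  assumes "dim_col A = dim_row B" and "dim_col B = dim_row C"
  shows "(A * B) * C = A * (B * C)"
  using assms assoc_mult_mat by (metis carrier_mat_triv)

text \<open>
  \<open>A\<close> factors as a split injection \<open>K\<close> after a split surjection \<open>L\<close> through dimension \<open>r\<close>. In this
  form the rank visibly survives base change and is additive on block sums.
\<close>

definition has_rank_factor :: "'k::field mat \<Rightarrow> nat \<Rightarrow> bool" where
  "has_rank_factor A r \<longleftrightarrow>
     (\<exists>K L U W. K \<in> carrier_mat (dim_row A) r \<and> L \<in> carrier_mat r (dim_col A) \<and>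
        U \<in> carrier_mat r (dim_row A) \<and> W \<in> carrier_mat (dim_col A) r \<and>
        A = K * L \<and> U * K = 1\<^sub>m r \<and> L * W = 1\<^sub>m r)"

lemma (in vec_space) mult_mat_vec_in_span_cols:
  assumes A: "A \<in> carrier_mat n nc" and v: "v \<in> carrier_vec nc"
  shows "A *\<^sub>v v \<in> span (set (cols A))"
proof -
  have cols: "set (cols A) \<subseteq> carrier_vec n"
    using cols_dim[of A] A by auto
  have "A *\<^sub>v v = mat_of_cols n (cols A) *\<^sub>v vec (length (cols A)) (\<lambda>i. v $ i)"
    using A v by (metis carrier_matD carrier_vecD cols_length dim_vec eq_vecI index_vec mat_of_cols_cols)
  also have "\<dots> = lincomb_list (\<lambda>i. v $ i) (cols A)"
    by (rule lincomb_list_as_mat_mult[symmetric]) (use cols in auto)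
  \<comment> \<open>Columns may coincide; \<open>mk_coeff\<close> adds up the coefficients of equal
    columns, so the combination of the list becomes one of the set.\<close>
  also have "\<dots> = lincomb (mk_coeff (cols A) (\<lambda>i. v $ i)) (set (cols A))"
    by (rule lincomb_list_as_lincomb) (use cols in auto)
  also have "\<dots> \<in> span (set (cols A))"
    unfolding span_def by (auto simp: class_ring_simps)
  finally show ?thesis .
qed

lemma (in vec_space) set_cols_mult_subset_span:
  assumes A: "A \<in> carrier_mat n m" and B: "B \<in> carrier_mat m nc"
  shows "set (cols (A * B)) \<subseteq> span (set (cols A))"
proof
  fix c assume "c \<in> set (cols (A * B))"
  then obtain j where j: "j < nc" "c = col (A * B) j"
    using A B by (auto simp: cols_def)
  then have "c = A *\<^sub>v col B j" using A B by (auto simp: col_mult2)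
  then show "c \<in> span (set (cols A))"
    using mult_mat_vec_in_span_cols[OF A, of "col B j"] B j by auto
qed

text \<open>Cancelling \<open>K\<close> with \<open>U\<close> shows that the columns are pairwise
  distinct and that the kernel of \<open>K\<close> is trivial. Distinctness is a separate step
  because independence is a property of the set of columns, which forgets repetitions.\<close>

lemma (in vec_space) rank_left_invertible:
  assumes K: "K \<in> carrier_mat n r" and U: "U \<in> carrier_mat r n" and UK: "U * K = 1\<^sub>m r"
  shows "rank K = r"
proof -
  have d: "distinct (cols K)"
  proof (unfold distinct_conv_nth, intro allI impI)
    fix i j assume ij: "i < length (cols K)" "j < length (cols K)" "i \<noteq> j"
    show "cols K ! i \<noteq> cols K ! j"
    proof
      assume eq: "cols K ! i = cols K ! j"
      have "i < r" "j < r" using ij K by auto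
      then have "col (U * K) i = col (U * K) j" using eq ij K U by (simp add: col_mult2)
      then have "unit_vec r i = (unit_vec r j :: 'a vec)" using UK \<open>i < r\<close> \<open>j < r\<close> by simp
      then show False using \<open>i < r\<close> \<open>j < r\<close> ij(3)
        by (metis index_unit_vec(1) one_neq_zero)
    qed
  qed
  have "lin_indpt (set (cols K))"
  proof
    assume "lin_dep (set (cols K))"
    then obtain v where v: "v \<in> carrier_vec r" "v \<noteq> 0\<^sub>v r" "K *\<^sub>v v = 0\<^sub>v n"
      using lin_depE[OF K _ d] by blast
    have "v = (U * K) *\<^sub>v v" using UK v by simp
    also have "\<dots> = U *\<^sub>v (K *\<^sub>v v)" using U K v by simp
    also have "\<dots> = 0\<^sub>v r" using U v(3) by auto
    finally show False using v by simp
  qed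
  then show ?thesis using lin_indpt_full_rank[OF K d] by simp
qed

text \<open>From \<open>A = K * L\<close> and \<open>K = A * W\<close> the matrices \<open>A\<close>
  and \<open>K\<close> have the same column space, and the left inverse \<open>U\<close> forces
  \<open>K\<close> to have rank \<open>r\<close>.\<close>

lemma mat_rank_eqI:
  assumes "has_rank_factor A r"
  shows "mat_rank A = r"
proof -
  define n nc where "n = dim_row A" and "nc = dim_col A"
  obtain K L U W where K: "K \<in> carrier_mat n r" and L: "L \<in> carrier_mat r nc"
    and U: "U \<in> carrier_mat r n" and W: "W \<in> carrier_mat nc r"
    and A: "A = K * L" and UK: "U * K = 1\<^sub>m r" and LW: "L * W = 1\<^sub>m r"
    using assms unfolding has_rank_factor_def n_def nc_def by blast
  have cA: "A \<in> carrier_mat n nc" by (simp add: n_def nc_def)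
  interpret vec_space "TYPE('a)" n .
  have K_eq: "K = A * W"
    unfolding A using K L W LW by (simp add: mult_assoc_dim)
  have sK: "set (cols K) \<subseteq> carrier_vec n" and sA: "set (cols A) \<subseteq> carrier_vec n"
    using cols_dim[of K] cols_dim[of A] K cA by auto
  have "span (set (cols A)) = span (set (cols K))"
  proof (rule subset_antisym)
    show "span (set (cols A)) \<subseteq> span (set (cols K))"
      using set_cols_mult_subset_span[OF K L] span_is_submodule[OF sK] unfolding A
      by (intro span_is_subset) auto
    show "span (set (cols K)) \<subseteq> span (set (cols A))"
      using set_cols_mult_subset_span[OF cA W] span_is_submodule[OF sA] unfolding K_eq
      by (intro span_is_subset) auto
  qed
  then have "rank A = rank K" unfolding rank_def by simp
  also have "\<dots> = r" by (rule rank_left_invertible[OF K U UK])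
  finally show ?thesis unfolding mat_rank_def n_def .
qed

section \<open>Block-diagonal matrices\<close>

definition block_diag :: "'a::zero mat \<Rightarrow> 'a mat \<Rightarrow> 'a mat" where
  "block_diag A D =
     four_block_mat A (0\<^sub>m (dim_row A) (dim_col D)) (0\<^sub>m (dim_row D) (dim_col A)) D"

lemma dim_block_diag [simp]:
  "dim_row (block_diag A D) = dim_row A + dim_row D"
  "dim_col (block_diag A D) = dim_col A + dim_col D"
  by (simp_all add: block_diag_def)

lemma block_diag_carrier:
  "A \<in> carrier_mat m n \<Longrightarrow> D \<in> carrier_mat m' n' \<Longrightarrow> block_diag A D \<in> carrier_mat (m + m') (n + n')"
  by (simp add: block_diag_def)

lemma block_diag_mult:
  fixes A B C D :: "'a::semiring_1 mat"
  assumes "dim_col A = dim_row B" and "dim_col C = dim_row D"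
  shows "block_diag A C * block_diag B D = block_diag (A * B) (C * D)"
proof -
  have "four_block_mat A (0\<^sub>m (dim_row A) (dim_col C)) (0\<^sub>m (dim_row C) (dim_col A)) C *
      four_block_mat B (0\<^sub>m (dim_row B) (dim_col D)) (0\<^sub>m (dim_row D) (dim_col B)) D =
    four_block_mat (A * B + 0\<^sub>m (dim_row A) (dim_col C) * 0\<^sub>m (dim_row D) (dim_col B))
      (A * 0\<^sub>m (dim_row B) (dim_col D) + 0\<^sub>m (dim_row A) (dim_col C) * D)
      (0\<^sub>m (dim_row C) (dim_col A) * B + C * 0\<^sub>m (dim_row D) (dim_col B))
      (0\<^sub>m (dim_row C) (dim_col A) * 0\<^sub>m (dim_row B) (dim_col D) + C * D)"
    by (rule mult_four_block_mat) (use assms in auto)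
  also have "\<dots> = block_diag (A * B) (C * D)"
    unfolding block_diag_def by (rule cong_four_block_mat) (use assms in auto)
  finally show ?thesis unfolding block_diag_def .
qed

lemma block_diag_one [simp]: "block_diag (1\<^sub>m m) (1\<^sub>m n) = 1\<^sub>m (m + n)"
  by (simp add: block_diag_def)

lemma block_diag_assoc: "block_diag A (block_diag B C) = block_diag (block_diag A B) C"
  using assoc_four_block_mat[of A B C] by (simp add: block_diag_def)

text \<open>All four witnesses are assembled blockwise, so ranks add without any argument about
  subspaces.\<close>

lemma has_rank_factor_block_diag:
  assumes "has_rank_factor A r" and "has_rank_factor B s"
  shows "has_rank_factor (block_diag A B) (r + s)"
proof -
  obtain K L U W where 1: "K \<in> carrier_mat (dim_row A) r" "L \<in> carrier_mat r (dim_col A)"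
    "U \<in> carrier_mat r (dim_row A)" "W \<in> carrier_mat (dim_col A) r"
    "A = K * L" "U * K = 1\<^sub>m r" "L * W = 1\<^sub>m r"
    using assms(1) unfolding has_rank_factor_def by blast
  obtain K' L' U' W' where 2: "K' \<in> carrier_mat (dim_row B) s" "L' \<in> carrier_mat s (dim_col B)"
    "U' \<in> carrier_mat s (dim_row B)" "W' \<in> carrier_mat (dim_col B) s"
    "B = K' * L'" "U' * K' = 1\<^sub>m s" "L' * W' = 1\<^sub>m s"
    using assms(2) unfolding has_rank_factor_def by blast
  show ?thesis
    unfolding has_rank_factor_def dim_block_diag
  proof (intro exI conjI)
    show "block_diag A B = block_diag K K' * block_diag L L'"
      using 1(1,2) 2(1,2) by (subst block_diag_mult) (auto simp: 1(5)[symmetric] 2(5)[symmetric])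
    show "block_diag U U' * block_diag K K' = 1\<^sub>m (r + s)"
      using 1(1,3,6) 2(1,3,6) by (subst block_diag_mult) auto
    show "block_diag L L' * block_diag W W' = 1\<^sub>m (r + s)"
      using 1(2,4,7) 2(2,4,7) by (subst block_diag_mult) auto
  qed (rule block_diag_carrier; fact)+
qed

lemma has_rank_factor_one: "has_rank_factor (1\<^sub>m n) n"
  unfolding has_rank_factor_def
  by (rule exI[of _ "1\<^sub>m n"], rule exI[of _ "1\<^sub>m n"], rule exI[of _ "1\<^sub>m n"],
      rule exI[of _ "1\<^sub>m n"]) auto

text \<open>A zero map factors through the zero space; the witnesses are empty matrices.\<close>

lemma has_rank_factor_zero: "has_rank_factor (0\<^sub>m m n) 0"
  unfolding has_rank_factor_def
  by (rule exI[of _ "0\<^sub>m m 0"], rule exI[of _ "0\<^sub>m 0 n"], rule exI[of _ "0\<^sub>m 0 m"],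
      rule exI[of _ "0\<^sub>m n 0"]) auto

text \<open>Since \<open>P\<close> is split injective and \<open>Q\<close> split surjective,
  \<open>P * K\<close> and \<open>L * Q\<close> keep the one-sided inverses \<open>U * P'\<close>
  and \<open>Q' * W\<close>.\<close>

lemma has_rank_factor_conj:
  assumes A: "has_rank_factor A r"
    and dims: "P \<in> carrier_mat m (dim_row A)" "P' \<in> carrier_mat (dim_row A) m"
      "Q \<in> carrier_mat (dim_col A) n" "Q' \<in> carrier_mat n (dim_col A)"
    and inv: "P' * P = 1\<^sub>m (dim_row A)" "Q * Q' = 1\<^sub>m (dim_col A)"
  shows "has_rank_factor (P * A * Q) r"
proof -
  obtain K L U W where 1: "K \<in> carrier_mat (dim_row A) r" "L \<in> carrier_mat r (dim_col A)"
    "U \<in> carrier_mat r (dim_row A)" "W \<in> carrier_mat (dim_col A) r"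
    "A = K * L" "U * K = 1\<^sub>m r" "L * W = 1\<^sub>m r"
    using A unfolding has_rank_factor_def by blast
  have "(U * P') * (P * K) = U * ((P' * P) * K)"
    using 1(1,3) dims by (simp add: mult_assoc_dim)
  also have "\<dots> = 1\<^sub>m r" using 1(1,6) inv(1) by simp
  finally have l: "(U * P') * (P * K) = 1\<^sub>m r" .
  have "(L * Q) * (Q' * W) = L * ((Q * Q') * W)"
    using 1(2,4) dims by (simp add: mult_assoc_dim)
  also have "\<dots> = 1\<^sub>m r" using 1(4,7) inv(2) by simp
  finally have r: "(L * Q) * (Q' * W) = 1\<^sub>m r" .
  have "(P * K) * (L * Q) = P * ((K * L) * Q)"
    using 1(1,2) dims by (simp add: mult_assoc_dim)
  also have "\<dots> = P * A * Q"
    unfolding 1(5)[symmetric] using dims by (simp add: mult_assoc_dim)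
  finally have eq: "P * A * Q = (P * K) * (L * Q)" by simp
  have dims': "dim_row (P * A * Q) = m" "dim_col (P * A * Q) = n" using dims by auto
  show ?thesis
    unfolding has_rank_factor_def dims'
  proof (intro exI conjI)
    show "P * K \<in> carrier_mat m r" "L * Q \<in> carrier_mat r n"
      "U * P' \<in> carrier_mat r m" "Q' * W \<in> carrier_mat n r"
      by (rule mult_carrier_mat; fact)+
  qed (fact eq l r)+
qed

section \<open>Path maps\<close>

text \<open>Indexed by starting vertex and length, unlike \<open>composite\<close>: the trivial path
  is included, and inductions run over the length.\<close>

primrec path_map :: "'k::field quiver_rep \<Rightarrow> nat \<Rightarrow> nat \<Rightarrow> 'k mat" where
  "path_map V i 0 = 1\<^sub>m (vdim V i)"
| "path_map V i (Suc k) = arrow V (i + k) * path_map V i k"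

lemma is_repD:
  "is_rep n V \<Longrightarrow> 1 \<le> i \<Longrightarrow> i < n \<Longrightarrow> arrow V i \<in> carrier_mat (vdim V (Suc i)) (vdim V i)"
  by (simp add: is_rep_def)

lemma path_map_carrier:
  assumes "is_rep n V" and "1 \<le> i" and "i + k \<le> n"
  shows "path_map V i k \<in> carrier_mat (vdim V (i + k)) (vdim V i)"
  using assms(3)
proof (induction k)
  case (Suc k)
  then show ?case using is_repD[OF assms(1), of "i + k"] assms(2) by auto
qed simp

lemma path_map_comp:
  assumes "is_rep n V" and "1 \<le> i" and "i + j + k \<le> n"
  shows "path_map V (i + j) k * path_map V i j = path_map V i (j + k)"
  using assms(3)
proof (induction k)
  case 0
  then show ?case using path_map_carrier[OF assms(1,2), of j] by simp
next
  case (Suc k)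
  have "arrow V (i + j + k) * path_map V (i + j) k * path_map V i j =
      arrow V (i + j + k) * (path_map V (i + j) k * path_map V i j)"
    using is_repD[OF assms(1), of "i + j + k"] path_map_carrier[OF assms(1), of "i + j" k]
      path_map_carrier[OF assms(1), of i j] assms(2) Suc.prems
    by (intro mult_assoc_dim) auto
  then show ?case using Suc by (simp add: add.assoc)
qed

text \<open>Pastes \<open>k\<close> commuting squares of the morphism together.\<close>

lemma path_map_hom:
  assumes V: "is_rep n V" and W: "is_rep n W" and f: "rep_hom n V W f"
    and i: "1 \<le> i" and "i + k \<le> n"
  shows "f (i + k) * path_map V i k = path_map W i k * f i"
  using assms(5)
proof (induction k)
  case 0
  have "f i \<in> carrier_mat (vdim W i) (vdim V i)" using f i 0 by (simp add: rep_hom_def)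
  then show ?case by simp
next
  case (Suc k)
  have c: "f (i + k) \<in> carrier_mat (vdim W (i + k)) (vdim V (i + k))"
      "f (Suc (i + k)) \<in> carrier_mat (vdim W (Suc (i + k))) (vdim V (Suc (i + k)))"
      "f i \<in> carrier_mat (vdim W i) (vdim V i)"
    using f i Suc.prems by (auto simp: rep_hom_def)
  note pc = path_map_carrier[OF V i, of k] path_map_carrier[OF W i, of k]
    is_repD[OF V, of "i + k"] is_repD[OF W, of "i + k"]
  have comm: "f (Suc (i + k)) * arrow V (i + k) = arrow W (i + k) * f (i + k)"
    using f i Suc.prems by (simp add: rep_hom_def)
  have "f (i + Suc k) * path_map V i (Suc k) = (f (Suc (i + k)) * arrow V (i + k)) * path_map V i k"
    using c pc Suc.prems i by (subst mult_assoc_dim) auto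
  also have "\<dots> = arrow W (i + k) * (f (i + k) * path_map V i k)"
    unfolding comm using c pc Suc.prems i by (subst mult_assoc_dim) auto
  also have "\<dots> = path_map W i (Suc k) * f i"
    using c pc Suc i by (simp add: mult_assoc_dim)
  finally show ?case .
qed

text \<open>The path map of \<open>V\<close> is that of \<open>W\<close> multiplied by
  \<open>g\<close> at the end vertex on the left and by \<open>f\<close> at the starting vertex on
  the right, both invertible, so \<open>has_rank_factor_conj\<close> applies.\<close>

lemma has_rank_factor_path_map_iso:
  assumes V: "is_rep n V" and W: "is_rep n W" and iso: "rep_iso n V W"
    and i: "1 \<le> i" and k: "i + k \<le> n" and rank: "has_rank_factor (path_map W i k) r"
  shows "has_rank_factor (path_map V i k) r"
proof -
  obtain f g where f: "rep_hom n V W f" and g: "rep_hom n W V g"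
    and inv: "\<And>j. j \<in> {1..n} \<Longrightarrow> g j * f j = 1\<^sub>m (vdim V j) \<and> f j * g j = 1\<^sub>m (vdim W j)"
    using iso unfolding rep_iso_def by blast
  have ij: "i \<in> {1..n}" "i + k \<in> {1..n}" using i k by auto
  have c: "f j \<in> carrier_mat (vdim W j) (vdim V j)" "g j \<in> carrier_mat (vdim V j) (vdim W j)"
    if "j \<in> {1..n}" for j using f g that by (auto simp: rep_hom_def)
  note pV = path_map_carrier[OF V i k] and pW = path_map_carrier[OF W i k]
  have "path_map V i k = (g (i + k) * f (i + k)) * path_map V i k"
    using inv[OF ij(2)] pV by simp
  also have "\<dots> = g (i + k) * (f (i + k) * path_map V i k)"
    using c[OF ij(2)] pV by (subst mult_assoc_dim) auto
  also have "\<dots> = g (i + k) * path_map W i k * f i"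
    unfolding path_map_hom[OF V W f i k] using c[OF ij(1)] c[OF ij(2)] pW
    by (subst mult_assoc_dim) auto
  finally show ?thesis
    using has_rank_factor_conj[OF rank, of "g (i + k)" _ "f (i + k)" "f i" _ "g i"]
      c[OF ij(1)] c[OF ij(2)] pW inv ij by auto
qed

section \<open>Path maps of direct sums and of intervals\<close>

definition rep_sum :: "'k::field quiver_rep \<Rightarrow> 'k quiver_rep \<Rightarrow> 'k quiver_rep" where
  "rep_sum V W = \<lparr> vdim = (\<lambda>i. vdim V i + vdim W i),
     arrow = (\<lambda>i. block_diag (arrow V i) (arrow W i)) \<rparr>"

lemma rep_sum_simps [simp]:
  "vdim (rep_sum V W) i = vdim V i + vdim W i"
  "arrow (rep_sum V W) i = block_diag (arrow V i) (arrow W i)"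
  by (simp_all add: rep_sum_def)

text \<open>Reduces sums over lists to the binary sum, where the calculus of
  \<open>block_diag\<close> is available.\<close>

lemma direct_sum_rep_Cons: "direct_sum_rep (V # Vs) = rep_sum V (direct_sum_rep Vs)"
  by (simp add: direct_sum_rep_def rep_sum_def block_diag_def Let_def)

lemma vdim_direct_sum_rep [simp]: "vdim (direct_sum_rep Vs) i = (\<Sum>V\<leftarrow>Vs. vdim V i)"
  by (simp add: direct_sum_rep_def)

lemma is_rep_rep_sum: "is_rep n V \<Longrightarrow> is_rep n W \<Longrightarrow> is_rep n (rep_sum V W)"
  by (simp add: is_rep_def block_diag_carrier)

lemma is_rep_direct_sum_rep: "\<forall>V\<in>set Vs. is_rep n V \<Longrightarrow> is_rep n (direct_sum_rep Vs)"
  by (induction Vs)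
    (auto simp: direct_sum_rep_Cons is_rep_rep_sum, simp add: is_rep_def direct_sum_rep_def)

lemma is_rep_interval_rep: "is_rep n (interval_rep b d)"
  by (auto simp: is_rep_def interval_rep_def interval_dim_def)

lemma path_map_rep_sum:
  assumes V: "is_rep n V" and W: "is_rep n W" and i: "1 \<le> i" and "i + k \<le> n"
  shows "path_map (rep_sum V W) i k = block_diag (path_map V i k) (path_map W i k)"
  using assms(4)
proof (induction k)
  case (Suc k)
  then show ?case
    using is_repD[OF V, of "i + k"] is_repD[OF W, of "i + k"] i
      path_map_carrier[OF V i, of k] path_map_carrier[OF W i, of k]
    by (simp add: block_diag_mult)
qed simp

text \<open>Outside the first case the matrix is empty: it has no columns if \<open>i < b\<close>
  and no rows if \<open>b \<le> i\<close> and \<open>d < i + k\<close>. Its dimensions then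
  determine it.\<close>

lemma path_map_interval_rep:
  "path_map (interval_rep b d :: 'k::field quiver_rep) i k =
    (if b \<le> i \<and> i + k \<le> d then 1\<^sub>m 1
     else 0\<^sub>m (interval_dim b d (i + k)) (interval_dim b d i))"
proof (induction k)
  case 0
  show ?case by (auto simp: interval_rep_def interval_dim_def intro!: eq_matI)
next
  case (Suc k)
  let ?I = "interval_rep b d :: 'k quiver_rep"
  have dims: "dim_row (path_map ?I i k) = interval_dim b d (i + k)"
    "dim_col (path_map ?I i k) = interval_dim b d i"
    unfolding Suc by (auto simp: interval_dim_def)
  consider (in_range) "b \<le> i" "i + Suc k \<le> d" | (below) "i < b"
    | (above) "b \<le> i" "d < i + Suc k" by linarith
  then show ?case
  proof cases
    case in_range
    then show ?thesis using Suc by (simp add: interval_rep_def)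
  next
    case below
    then have "dim_col (path_map ?I i k) = 0" using dims by (simp add: interval_dim_def)
    then show ?thesis using below
      by (intro eq_matI) (auto simp: interval_rep_def interval_dim_def)
  next
    case above
    then have "dim_row (path_map ?I i (Suc k)) = 0"
      by (simp add: interval_rep_def interval_dim_def)
    then show ?thesis using above dims by (intro eq_matI) (auto simp: interval_dim_def)
  qed
qed

text \<open>The product of dimensions is the indicator of both ends of the path lying in the
  interval, which then contains the whole path.\<close>

lemma has_rank_factor_path_map_interval_rep:
  "has_rank_factor (path_map (interval_rep b d :: 'k::field quiver_rep) i k)
    (interval_dim b d i * interval_dim b d (i + k))"
  using has_rank_factor_one[of 1, where ?'a = 'k]
  by (auto simp: path_map_interval_rep interval_dim_def has_rank_factor_zero)

lemma has_rank_factor_path_map_direct_sum: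
  fixes Vs :: "'k::field quiver_rep list"
  assumes "\<forall>V\<in>set Vs. is_rep n V" and i: "1 \<le> i" and k: "i + k \<le> n"
    and "\<forall>V\<in>set Vs. has_rank_factor (path_map V i k) (\<rho> V)"
  shows "has_rank_factor (path_map (direct_sum_rep Vs) i k) (\<Sum>V\<leftarrow>Vs. \<rho> V)"
  using assms(1,4)
proof (induction Vs)
  case Nil
  have "path_map (direct_sum_rep []) i k = (0\<^sub>m 0 0 :: 'k mat)"
    using path_map_carrier[OF is_rep_direct_sum_rep[OF Nil(1)] i k] by (intro eq_matI) auto
  then show ?case by (simp add: has_rank_factor_zero)
next
  case (Cons V Vs)
  then have V: "is_rep n V" and Vs: "\<forall>V\<in>set Vs. is_rep n V" by auto
  have eq: "path_map (direct_sum_rep (V # Vs)) i k =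
      block_diag (path_map V i k) (path_map (direct_sum_rep Vs) i k)"
    unfolding direct_sum_rep_Cons
    by (rule path_map_rep_sum[OF V is_rep_direct_sum_rep[OF Vs] i k])
  have "has_rank_factor (path_map V i k) (\<rho> V)" using Cons.prems by simp
  then show ?case
    unfolding eq list.map sum_list.Cons using Cons.IH[OF Vs] Cons.prems
    by (intro has_rank_factor_block_diag) auto
qed

section \<open>Isomorphisms and direct sums of representations\<close>

lemma rep_homD:
  assumes "rep_hom n V W f"
  shows "1 \<le> i \<Longrightarrow> i \<le> n \<Longrightarrow> f i \<in> carrier_mat (vdim W i) (vdim V i)"
    and "1 \<le> i \<Longrightarrow> i < n \<Longrightarrow> f (Suc i) * arrow V i = arrow W i * f i"
  using assms by (auto simp: rep_hom_def)

lemma rep_homI: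
  assumes "\<And>i. 1 \<le> i \<Longrightarrow> i \<le> n \<Longrightarrow> f i \<in> carrier_mat (vdim W i) (vdim V i)"
    and "\<And>i. 1 \<le> i \<Longrightarrow> i < n \<Longrightarrow> f (Suc i) * arrow V i = arrow W i * f i"
  shows "rep_hom n V W f"
  using assms by (auto simp: rep_hom_def)

text \<open>Pointwise inverses of a morphism commute with the arrows automatically: insert
  \<open>f i * g i\<close>, carry \<open>f\<close> across the arrow and cancel it against
  \<open>g (Suc i)\<close>.\<close>

lemma rep_isoI:
  assumes V: "is_rep n V" and W: "is_rep n W" and f: "rep_hom n V W f"
    and g: "\<And>i. 1 \<le> i \<Longrightarrow> i \<le> n \<Longrightarrow> g i \<in> carrier_mat (vdim V i) (vdim W i)"
    and gf: "\<And>i. 1 \<le> i \<Longrightarrow> i \<le> n \<Longrightarrow> g i * f i = 1\<^sub>m (vdim V i)"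
    and fg: "\<And>i. 1 \<le> i \<Longrightarrow> i \<le> n \<Longrightarrow> f i * g i = 1\<^sub>m (vdim W i)"
  shows "rep_iso n V W"
proof -
  have "rep_hom n W V g"
  proof (rule rep_homI)
    fix i assume i: "1 \<le> i" "i < n"
    have i': "1 \<le> i" "i \<le> n" and Si: "1 \<le> Suc i" "Suc i \<le> n" using i by auto
    note c = rep_homD(1)[OF f i'] rep_homD(1)[OF f Si] g[OF i'] g[OF Si] is_repD[OF V i] is_repD[OF W i]
    have "g (Suc i) * arrow W i = g (Suc i) * (arrow W i * (f i * g i))"
      using c fg[OF i'] by simp
    also have "\<dots> = g (Suc i) * ((arrow W i * f i) * g i)" using c by (simp add: mult_assoc_dim)
    also have "\<dots> = (g (Suc i) * f (Suc i)) * (arrow V i * g i)"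
      unfolding rep_homD(2)[OF f i, symmetric] using c by (simp add: mult_assoc_dim)
    also have "\<dots> = arrow V i * g i" unfolding gf[OF Si] using c by simp
    finally show "g (Suc i) * arrow W i = arrow V i * g i" .
  qed (rule g)
  then show ?thesis
    unfolding rep_iso_def using f gf fg by (intro exI[of _ f] exI[of _ g]) auto
qed

lemma rep_iso_refl:
  assumes "is_rep n V" shows "rep_iso n V V"
proof -
  have "rep_hom n V V (\<lambda>i. 1\<^sub>m (vdim V i))"
  proof (rule rep_homI)
    fix i assume "1 \<le> i" "i < n"
    then show "1\<^sub>m (vdim V (Suc i)) * arrow V i = arrow V i * 1\<^sub>m (vdim V i)"
      using is_repD[OF assms, of i] by simp
  qed simp
  then show ?thesis by (rule rep_isoI[OF assms assms, of _ "\<lambda>i. 1\<^sub>m (vdim V i)"]) auto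
qed

lemma rep_iso_trans:
  assumes V: "is_rep n V" and W: "is_rep n W" and X: "is_rep n X"
    and "rep_iso n V W" and "rep_iso n W X"
  shows "rep_iso n V X"
proof -
  obtain f g where f: "rep_hom n V W f" and g: "rep_hom n W V g"
    and inv: "\<And>i. i \<in> {1..n} \<Longrightarrow> g i * f i = 1\<^sub>m (vdim V i) \<and> f i * g i = 1\<^sub>m (vdim W i)"
    using assms(4) unfolding rep_iso_def by blast
  obtain f' g' where f': "rep_hom n W X f'" and g': "rep_hom n X W g'"
    and inv': "\<And>i. i \<in> {1..n} \<Longrightarrow> g' i * f' i = 1\<^sub>m (vdim W i) \<and> f' i * g' i = 1\<^sub>m (vdim X i)"
    using assms(5) unfolding rep_iso_def by blast
  note c = rep_homD(1)[OF f] rep_homD(1)[OF g] rep_homD(1)[OF f'] rep_homD(1)[OF g']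
  show ?thesis
  proof (rule rep_isoI[OF V X, of "\<lambda>i. f' i * f i" "\<lambda>i. g i * g' i"])
    show "rep_hom n V X (\<lambda>i. f' i * f i)"
    proof (rule rep_homI)
      fix i assume i: "1 \<le> i" "i < n"
      have i': "1 \<le> i" "i \<le> n" and Si: "1 \<le> Suc i" "Suc i \<le> n" using i by auto
      note c' = c[OF i'] c[OF Si] is_repD[OF V i] is_repD[OF W i] is_repD[OF X i]
      have "f' (Suc i) * f (Suc i) * arrow V i = f' (Suc i) * (f (Suc i) * arrow V i)"
        using c' by (simp add: mult_assoc_dim)
      also have "\<dots> = (f' (Suc i) * arrow W i) * f i"
        unfolding rep_homD(2)[OF f i] using c' by (simp add: mult_assoc_dim)
      also have "\<dots> = arrow X i * (f' i * f i)"
        unfolding rep_homD(2)[OF f' i] using c' by (simp add: mult_assoc_dim)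
      finally show "f' (Suc i) * f (Suc i) * arrow V i = arrow X i * (f' i * f i)" .
    qed (rule mult_carrier_mat[OF c(3) c(1)])
  next
    fix i assume i: "1 \<le> i" "i \<le> n"
    show "g i * g' i \<in> carrier_mat (vdim V i) (vdim X i)" using c[OF i] by auto
    have "g i * g' i * (f' i * f i) = g i * ((g' i * f' i) * f i)"
      using c[OF i] by (simp add: mult_assoc_dim)
    also have "\<dots> = 1\<^sub>m (vdim V i)" using inv[of i] inv'[of i] i c[OF i] by simp
    finally show "g i * g' i * (f' i * f i) = 1\<^sub>m (vdim V i)" .
    have "f' i * f i * (g i * g' i) = f' i * ((f i * g i) * g' i)"
      using c[OF i] by (simp add: mult_assoc_dim)
    also have "\<dots> = 1\<^sub>m (vdim X i)" using inv[of i] inv'[of i] i c[OF i] by simp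
    finally show "f' i * f i * (g i * g' i) = 1\<^sub>m (vdim X i)" .
  qed
qed

lemma rep_iso_rep_sum_cong:
  assumes V: "is_rep n V" "is_rep n V'" and W: "is_rep n W" "is_rep n W'"
    and "rep_iso n V V'" and "rep_iso n W W'"
  shows "rep_iso n (rep_sum V W) (rep_sum V' W')"
proof -
  obtain f g where f: "rep_hom n V V' f" and g: "rep_hom n V' V g"
    and inv: "\<And>i. i \<in> {1..n} \<Longrightarrow> g i * f i = 1\<^sub>m (vdim V i) \<and> f i * g i = 1\<^sub>m (vdim V' i)"
    using assms(5) unfolding rep_iso_def by blast
  obtain f' g' where f': "rep_hom n W W' f'" and g': "rep_hom n W' W g'"
    and inv': "\<And>i. i \<in> {1..n} \<Longrightarrow> g' i * f' i = 1\<^sub>m (vdim W i) \<and> f' i * g' i = 1\<^sub>m (vdim W' i)"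
    using assms(6) unfolding rep_iso_def by blast
  note c = rep_homD(1)[OF f] rep_homD(1)[OF g] rep_homD(1)[OF f'] rep_homD(1)[OF g']
  show ?thesis
  proof (rule rep_isoI[of _ _ _ "\<lambda>i. block_diag (f i) (f' i)" "\<lambda>i. block_diag (g i) (g' i)"])
    show "rep_hom n (rep_sum V W) (rep_sum V' W') (\<lambda>i. block_diag (f i) (f' i))"
    proof (rule rep_homI)
      fix i assume i: "1 \<le> i" "i < n"
      have i': "1 \<le> i" "i \<le> n" and Si: "1 \<le> Suc i" "Suc i \<le> n" using i by auto
      note c' = c[OF i'] c[OF Si] is_repD[OF V(1) i] is_repD[OF V(2) i] is_repD[OF W(1) i]
        is_repD[OF W(2) i]
      show "block_diag (f (Suc i)) (f' (Suc i)) * arrow (rep_sum V W) i =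
          arrow (rep_sum V' W') i * block_diag (f i) (f' i)"
        using c' rep_homD(2)[OF f i] rep_homD(2)[OF f' i] by (simp add: block_diag_mult)
    qed (simp add: block_diag_carrier c)
  next
    fix i assume i: "1 \<le> i" "i \<le> n"
    show "block_diag (g i) (g' i) \<in> carrier_mat (vdim (rep_sum V W) i) (vdim (rep_sum V' W') i)"
      using c[OF i] by (simp add: block_diag_carrier)
    show "block_diag (g i) (g' i) * block_diag (f i) (f' i) = 1\<^sub>m (vdim (rep_sum V W) i)"
      using c[OF i] inv[of i] inv'[of i] i by (subst block_diag_mult) auto
    show "block_diag (f i) (f' i) * block_diag (g i) (g' i) = 1\<^sub>m (vdim (rep_sum V' W') i)"
      using c[OF i] inv[of i] inv'[of i] i by (subst block_diag_mult) auto
  qed (intro is_rep_rep_sum V W)+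
qed

section \<open>Reordering the summands of a direct sum\<close>

definition swap_mat :: "nat \<Rightarrow> nat \<Rightarrow> 'a::{zero,one} mat" where
  "swap_mat m n = four_block_mat (0\<^sub>m n m) (1\<^sub>m n) (1\<^sub>m m) (0\<^sub>m m n)"

lemma swap_mat_carrier [simp]: "swap_mat m n \<in> carrier_mat (n + m) (m + n)"
  by (simp add: swap_mat_def)

lemma swap_mat_mult_swap_mat:
  "swap_mat n m * swap_mat m n = (1\<^sub>m (m + n) :: 'a::semiring_1 mat)"
  unfolding swap_mat_def
  by (subst mult_four_block_mat[of _ m n _ m _ n _ _ m _ n]) auto

text \<open>Both products are the matrix with \<open>D\<close> and \<open>A\<close> as off-diagonal
  blocks. Hence exchanging the two coordinate blocks at every vertex is a morphism.\<close>

lemma swap_mat_mult_block_diag: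
  fixes A D :: "'a::semiring_1 mat"
  assumes A: "A \<in> carrier_mat m m'" and D: "D \<in> carrier_mat n n'"
  shows "swap_mat m n * block_diag A D = block_diag D A * swap_mat m' n'"
proof -
  have "swap_mat m n * block_diag A D = four_block_mat (0\<^sub>m n m') D A (0\<^sub>m m n')"
    unfolding swap_mat_def block_diag_def using A D
    by (subst mult_four_block_mat[of _ n m _ n _ m _ _ m' _ n']) auto
  also have "\<dots> = block_diag D A * swap_mat m' n'"
    unfolding swap_mat_def block_diag_def using A D
    by (subst mult_four_block_mat[of _ n n' _ m' _ m _ _ m' _ n']) auto
  finally show ?thesis .
qed

lemma rep_iso_rep_sum_commute:
  assumes V: "is_rep n V" and W: "is_rep n W"
  shows "rep_iso n (rep_sum V W) (rep_sum W V)"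
proof (rule rep_isoI[of _ _ _ "\<lambda>i. swap_mat (vdim V i) (vdim W i)"
      "\<lambda>i. swap_mat (vdim W i) (vdim V i)"])
  show "rep_hom n (rep_sum V W) (rep_sum W V) (\<lambda>i. swap_mat (vdim V i) (vdim W i))"
    by (rule rep_homI) (auto simp: swap_mat_mult_block_diag[OF is_repD[OF V] is_repD[OF W]])
  show "swap_mat (vdim W i) (vdim V i) \<in> carrier_mat (vdim (rep_sum V W) i) (vdim (rep_sum W V) i)"
    for i using swap_mat_carrier[of "vdim W i" "vdim V i"] by (simp add: add.commute)
qed (auto simp: swap_mat_mult_swap_mat add.commute is_rep_rep_sum V W)

text \<open>By \<open>block_diag_assoc\<close> the binary sum is associative as an equality, so
  passing \<open>V\<close> over one summand \<open>X\<close> only takes a swap of the two leading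
  summands.\<close>

lemma rep_iso_direct_sum_rep_move:
  fixes Vs Ws :: "'k::field quiver_rep list"
  assumes V: "is_rep n V" and Vs: "\<forall>X\<in>set Vs. is_rep n X" and Ws: "\<forall>X\<in>set Ws. is_rep n X"
  shows "rep_iso n (direct_sum_rep (V # Vs @ Ws)) (direct_sum_rep (Vs @ V # Ws))"
  using Vs
proof (induction Vs)
  case Nil
  have "is_rep n (direct_sum_rep (V # Ws))"
    by (rule is_rep_direct_sum_rep) (use V Ws in auto)
  then show ?case by (simp add: rep_iso_refl)
next
  case (Cons X Vs)
  let ?D = "direct_sum_rep (Vs @ Ws)"
  have X: "is_rep n X" and D: "is_rep n ?D" and D': "is_rep n (direct_sum_rep (Vs @ V # Ws))"
    using Cons.prems V Ws by (auto intro!: is_rep_direct_sum_rep)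
  have assoc: "rep_sum V (rep_sum X ?D) = rep_sum (rep_sum V X) ?D"
    "rep_sum X (rep_sum V ?D) = rep_sum (rep_sum X V) ?D"
    by (simp_all add: rep_sum_def block_diag_assoc add.assoc)
  have 1: "rep_iso n (rep_sum V (rep_sum X ?D)) (rep_sum X (rep_sum V ?D))"
    unfolding assoc
    by (intro rep_iso_rep_sum_cong rep_iso_rep_sum_commute rep_iso_refl is_rep_rep_sum V X D)
  have 2: "rep_iso n (rep_sum X (rep_sum V ?D)) (rep_sum X (direct_sum_rep (Vs @ V # Ws)))"
    using rep_iso_rep_sum_cong[OF X X _ D' rep_iso_refl[OF X] Cons.IH] Cons.prems V D
    by (simp add: direct_sum_rep_Cons is_rep_rep_sum)
  show ?case
    using rep_iso_trans[OF _ _ _ 1 2] V X D D'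
    by (simp add: direct_sum_rep_Cons is_rep_rep_sum)
qed

text \<open>Serves to bring an arbitrary list of interval summands into the fixed order used by
  \<open>interval_sum\<close>.\<close>

lemma rep_iso_direct_sum_rep_perm:
  fixes Vs Ws :: "'k::field quiver_rep list"
  assumes "mset Vs = mset Ws" and "\<forall>X\<in>set Vs. is_rep n X"
  shows "rep_iso n (direct_sum_rep Vs) (direct_sum_rep Ws)"
  using assms
proof (induction Vs arbitrary: Ws)
  case Nil
  then show ?case by (simp add: rep_iso_refl is_rep_direct_sum_rep)
next
  case (Cons V Vs)
  have "V \<in> set Ws" using Cons.prems(1) by (metis list.set_intros(1) set_mset_mset)
  then obtain As Bs where Ws: "Ws = As @ V # Bs" by (meson split_list)
  have m: "mset Vs = mset (As @ Bs)" using Cons.prems(1) Ws by simp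
  have V: "is_rep n V" and Vs: "\<forall>X\<in>set Vs. is_rep n X" using Cons.prems by auto
  have AB: "\<forall>X\<in>set (As @ Bs). is_rep n X" using Vs m by (metis set_mset_mset)
  have 1: "rep_iso n (direct_sum_rep (V # Vs)) (direct_sum_rep (V # As @ Bs))"
    unfolding direct_sum_rep_Cons
    by (intro rep_iso_rep_sum_cong rep_iso_refl V is_rep_direct_sum_rep Vs AB Cons.IH m)
  have 2: "rep_iso n (direct_sum_rep (V # As @ Bs)) (direct_sum_rep Ws)"
    unfolding Ws using AB by (intro rep_iso_direct_sum_rep_move V) auto
  show ?case
    by (rule rep_iso_trans[OF _ _ _ 1 2]; rule is_rep_direct_sum_rep) (use V Vs AB Ws in auto)
qed

section \<open>Splitting off a summand\<close>

text \<open>Stacking is encoded by block matrices with empty outer blocks, so that the product rules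
  below become instances of \<open>mult_four_block_mat\<close>.\<close>

definition vstack :: "'a::zero mat \<Rightarrow> 'a mat \<Rightarrow> 'a mat" where
  "vstack A B = four_block_mat A (0\<^sub>m (dim_row A) 0) B (0\<^sub>m (dim_row B) 0)"

definition hstack :: "'a::zero mat \<Rightarrow> 'a mat \<Rightarrow> 'a mat" where
  "hstack A B = four_block_mat A B (0\<^sub>m 0 (dim_col A)) (0\<^sub>m 0 (dim_col B))"

lemma vstack_carrier:
  "A \<in> carrier_mat m k \<Longrightarrow> B \<in> carrier_mat n k \<Longrightarrow> vstack A B \<in> carrier_mat (m + n) k"
  unfolding vstack_def by auto

lemma hstack_carrier:
  "A \<in> carrier_mat k m \<Longrightarrow> B \<in> carrier_mat k n \<Longrightarrow> hstack A B \<in> carrier_mat k (m + n)"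
  unfolding hstack_def by auto

context
  fixes A B C D :: "'a::semiring_1 mat" and m n k l p :: nat
begin

lemma vstack_mult:
  assumes "A \<in> carrier_mat m k" "B \<in> carrier_mat n k" "C \<in> carrier_mat k l"
  shows "vstack A B * C = vstack (A * C) (B * C)"
proof -
  have "C = four_block_mat C (0\<^sub>m k 0) (0\<^sub>m 0 l) (0\<^sub>m 0 0)"
    using assms by (intro eq_matI) auto
  then have "vstack A B * C = vstack A B * four_block_mat C (0\<^sub>m k 0) (0\<^sub>m 0 l) (0\<^sub>m 0 0)"
    by simp
  also have "\<dots> = vstack (A * C) (B * C)"
    unfolding vstack_def using assms
    by (subst mult_four_block_mat[of _ m k _ 0 _ n _ _ l _ 0]) auto
  finally show ?thesis .
qed

lemma vstack_mult_hstack: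
  assumes "A \<in> carrier_mat m k" "B \<in> carrier_mat n k" "C \<in> carrier_mat k l" "D \<in> carrier_mat k p"
  shows "vstack A B * hstack C D = four_block_mat (A * C) (A * D) (B * C) (B * D)"
  unfolding vstack_def hstack_def using assms
  by (subst mult_four_block_mat[of _ m k _ 0 _ n _ _ l _ p]) auto

lemma hstack_mult_vstack:
  assumes "A \<in> carrier_mat m k" "B \<in> carrier_mat m l" "C \<in> carrier_mat k n" "D \<in> carrier_mat l n"
  shows "hstack A B * vstack C D = A * C + B * D"
proof -
  have "hstack A B * vstack C D =
      four_block_mat (A * C + B * D) (0\<^sub>m m 0) (0\<^sub>m 0 n) (0\<^sub>m 0 0)"
    unfolding vstack_def hstack_def using assms
    by (subst mult_four_block_mat[of _ m k _ l _ 0 _ _ n _ 0]) auto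
  also have "\<dots> = A * C + B * D" using assms by (intro eq_matI) auto
  finally show ?thesis .
qed

lemma block_diag_mult_vstack:
  assumes "A \<in> carrier_mat m k" "B \<in> carrier_mat n l" "C \<in> carrier_mat k p" "D \<in> carrier_mat l p"
  shows "block_diag A B * vstack C D = vstack (A * C) (B * D)"
  unfolding vstack_def block_diag_def using assms
  by (subst mult_four_block_mat[of _ m k _ l _ n _ _ p _ 0]) auto

end

text \<open>
  A splitting of the idempotent \<open>w * p\<close>: \<open>K\<close> and \<open>L\<close> identify the complementary summand, of
  dimension \<open>r\<close>, with a coordinate space.
\<close>

definition complementary_pair :: "nat \<Rightarrow> 'k::field mat \<Rightarrow> 'k mat \<Rightarrow> nat \<Rightarrow> 'k mat \<Rightarrow> 'k mat \<Rightarrow> bool" where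
  "complementary_pair a w p r K L \<longleftrightarrow> K \<in> carrier_mat a r \<and> L \<in> carrier_mat r a \<and>
     p * K = 0\<^sub>m (dim_row p) r \<and> L * w = 0\<^sub>m r (dim_col w) \<and> L * K = 1\<^sub>m r"

text \<open>For \<open>c = 0\<close> the complement is everything. For \<open>c = 1\<close>,
  \<open>p\<close> is a functional with value 1 on the vector \<open>w\<close>, and its kernel, a
  hyperplane, is the complement; a coordinate with nonzero coefficient in \<open>p\<close> is
  eliminated explicitly.\<close>

lemma complementary_pair_exists:
  fixes w p :: "'k::field mat"
  assumes w: "w \<in> carrier_mat a c" and p: "p \<in> carrier_mat c a" and pw: "p * w = 1\<^sub>m c"
    and c: "c \<le> 1"
  obtains K L where "c \<le> a" and "complementary_pair a w p (a - c) K L"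
proof (cases "c = 0")
  case True
  then have "complementary_pair a w p (a - c) (1\<^sub>m a) (1\<^sub>m a)"
    using w p by (auto simp: complementary_pair_def intro!: eq_matI)
  then show ?thesis using that True by blast
next
  case False
  then have c1: "c = 1" using c by simp
  have dot: "(\<Sum>t<a. p $$ (0, t) * w $$ (t, 0)) = 1"
  proof -
    have "(p * w) $$ (0, 0) = 1" using pw c1 by simp
    then show ?thesis using p w c1 by (simp add: scalar_prod_def lessThan_atLeast0)
  qed
  obtain k where k: "k < a" "p $$ (0, k) \<noteq> 0"
  proof -
    have "\<exists>k<a. p $$ (0, k) \<noteq> 0"
    proof (rule ccontr)
      assume "\<not> ?thesis"
      then have "(\<Sum>t<a. p $$ (0, t) * w $$ (t, 0)) = 0" by (intro sum.neutral) auto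
      with dot show False by simp
    qed
    then show thesis using that by blast
  qed
  \<comment> \<open>\<open>\<sigma>\<close> enumerates the coordinates other than the pivot \<open>k\<close>, which parametrise the kernel of \<open>p\<close>.\<close>
  define \<sigma> where "\<sigma> j = (if j < k then j else Suc j)" for j :: nat
  have \<sigma>_less: "\<sigma> j < a" "\<sigma> j \<noteq> k" if "j < a - 1" for j
    using that k by (auto simp: \<sigma>_def)
  have \<sigma>_eq: "\<sigma> i = \<sigma> j \<longleftrightarrow> i = j" for i j by (auto simp: \<sigma>_def)
  \<comment> \<open>Column \<open>j\<close> is the unit vector at \<open>\<sigma> j\<close>,
    corrected in the pivot coordinate so that \<open>p\<close> annihilates it.\<close>
  define K where "K = mat a (a - 1) (\<lambda>(i, j). if i = \<sigma> j then 1
    else if i = k then - p $$ (0, \<sigma> j) / p $$ (0, k) else 0)"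
  \<comment> \<open>The projection \<open>1 - w * p\<close> onto the kernel of \<open>p\<close>,
    followed by deletion of coordinate \<open>k\<close>.\<close>
  define L where "L = mat (a - 1) a (\<lambda>(i, j). (if \<sigma> i = j then 1 else 0) - w $$ (\<sigma> i, 0) * p $$ (0, j))"
  have pK: "(\<Sum>t<a. p $$ (0, t) * K $$ (t, j)) = 0" if j: "j < a - 1" for j
  proof -
    have "(\<Sum>t<a. p $$ (0, t) * K $$ (t, j)) =
        (\<Sum>t<a. (if t = \<sigma> j then p $$ (0, t) else 0) + (if t = k then - p $$ (0, \<sigma> j) else 0))"
      using k j \<sigma>_less[OF j] by (intro sum.cong) (auto simp: K_def)
    also have "\<dots> = 0" using k \<sigma>_less[OF j] by (simp add: sum.distrib sum.delta)
    finally show ?thesis .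
  qed
  have Lw: "(\<Sum>t<a. L $$ (i, t) * w $$ (t, 0)) = 0" if i: "i < a - 1" for i
  proof -
    have "(\<Sum>t<a. L $$ (i, t) * w $$ (t, 0)) =
        (\<Sum>t<a. (if t = \<sigma> i then w $$ (t, 0) else 0) - w $$ (\<sigma> i, 0) * (p $$ (0, t) * w $$ (t, 0)))"
      using i by (intro sum.cong) (auto simp: L_def algebra_simps)
    also have "\<dots> = 0"
      using \<sigma>_less[OF i] dot by (simp add: sum_subtractf sum_distrib_left[symmetric] sum.delta)
    finally show ?thesis .
  qed
  have LK: "(\<Sum>t<a. L $$ (i, t) * K $$ (t, j)) = (if i = j then 1 else 0)"
    if i: "i < a - 1" and j: "j < a - 1" for i j
  proof -
    have "(\<Sum>t<a. L $$ (i, t) * K $$ (t, j)) =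
        (\<Sum>t<a. (if t = \<sigma> i then K $$ (t, j) else 0) - w $$ (\<sigma> i, 0) * (p $$ (0, t) * K $$ (t, j)))"
      using i by (intro sum.cong) (auto simp: L_def algebra_simps)
    also have "\<dots> = K $$ (\<sigma> i, j)"
      using \<sigma>_less[OF i] pK[OF j] by (simp add: sum_subtractf sum_distrib_left[symmetric] sum.delta)
    also have "\<dots> = (if i = j then 1 else 0)"
      using \<sigma>_less[OF i] j by (auto simp: K_def \<sigma>_eq)
    finally show ?thesis .
  qed
  have dimK: "dim_row K = a" "dim_col K = a - 1" and dimL: "dim_row L = a - 1" "dim_col L = a"
    by (simp_all add: K_def L_def)
  have "complementary_pair a w p (a - 1) K L"
    unfolding complementary_pair_def
  proof (intro conjI)
    show "p * K = 0\<^sub>m (dim_row p) (a - 1)"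
      using p c1 dimK pK by (intro eq_matI) (auto simp: scalar_prod_def lessThan_atLeast0)
    show "L * w = 0\<^sub>m (a - 1) (dim_col w)"
      using w c1 dimL Lw by (intro eq_matI) (auto simp: scalar_prod_def lessThan_atLeast0)
    show "L * K = 1\<^sub>m (a - 1)"
      using dimK dimL LK by (intro eq_matI) (auto simp: scalar_prod_def lessThan_atLeast0)
  qed (auto simp: K_def L_def)
  then show ?thesis using that k(1) c1 by simp
qed

text \<open>The four blocks of the first product are the defining equations. The matrices are square
  over a field, so this one-sided inverse is two-sided, and expanding the other product gives the
  third claim.\<close>

lemma complementary_pair_inverse:
  fixes w p :: "'k::field mat"
  assumes w: "w \<in> carrier_mat a c" and p: "p \<in> carrier_mat c a" and pw: "p * w = 1\<^sub>m c"
    and "c \<le> a" and KL: "complementary_pair a w p (a - c) K L"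
  shows "vstack p L * hstack w K = 1\<^sub>m a" and "hstack w K * vstack p L = 1\<^sub>m a"
    and "w * p + K * L = 1\<^sub>m a"
proof -
  have K: "K \<in> carrier_mat a (a - c)" and L: "L \<in> carrier_mat (a - c) a"
    and z: "p * K = 0\<^sub>m c (a - c)" "L * w = 0\<^sub>m (a - c) c" "L * K = 1\<^sub>m (a - c)"
    using KL w p by (auto simp: complementary_pair_def)
  have ca: "c + (a - c) = a" using \<open>c \<le> a\<close> by simp
  have c1: "vstack p L \<in> carrier_mat a a" and c2: "hstack w K \<in> carrier_mat a a"
    using vstack_carrier[OF p L] hstack_carrier[OF w K] ca by simp_all
  show 1: "vstack p L * hstack w K = 1\<^sub>m a"
    unfolding vstack_mult_hstack[OF p L w K] z pw four_block_one_mat ca ..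
  show 2: "hstack w K * vstack p L = 1\<^sub>m a"
    by (rule mat_mult_left_right_inverse[OF c1 c2 1])
  show "w * p + K * L = 1\<^sub>m a"
    using 2 unfolding hstack_mult_vstack[OF w K p L] .
qed

text \<open>The complement is the kernel of \<open>\<pi>\<close>, written in the coordinates given
  by \<open>K\<close> and \<open>L\<close>. The isomorphism stacks \<open>\<pi>\<close> on
  \<open>L\<close>; its inverse puts \<open>\<iota>\<close> beside \<open>K\<close>.\<close>

lemma split_off_summand:
  fixes I V :: "'k::field quiver_rep"
  assumes V: "is_rep n V" and I: "is_rep n I"
    and \<iota>: "rep_hom n I V \<iota>" and \<pi>: "rep_hom n V I \<pi>"
    and \<pi>\<iota>: "\<And>i. 1 \<le> i \<Longrightarrow> i \<le> n \<Longrightarrow> \<pi> i * \<iota> i = 1\<^sub>m (vdim I i)"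
    and thin: "\<And>i. 1 \<le> i \<Longrightarrow> i \<le> n \<Longrightarrow> vdim I i \<le> 1"
  obtains V' where "is_rep n V'" and "rep_iso n V (rep_sum I V')"
    and "\<And>i. 1 \<le> i \<Longrightarrow> i \<le> n \<Longrightarrow> vdim V i = vdim I i + vdim V' i"
proof -
  have "\<forall>i. \<exists>K L. 1 \<le> i \<longrightarrow> i \<le> n \<longrightarrow>
      vdim I i \<le> vdim V i \<and> complementary_pair (vdim V i) (\<iota> i) (\<pi> i) (vdim V i - vdim I i) K L"
    using complementary_pair_exists[OF rep_homD(1)[OF \<iota>] rep_homD(1)[OF \<pi>] \<pi>\<iota> thin] by metis
  then obtain K L where le: "\<And>i. 1 \<le> i \<Longrightarrow> i \<le> n \<Longrightarrow> vdim I i \<le> vdim V i"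
    and KL: "\<And>i. 1 \<le> i \<Longrightarrow> i \<le> n \<Longrightarrow>
      complementary_pair (vdim V i) (\<iota> i) (\<pi> i) (vdim V i - vdim I i) (K i) (L i)"
    by metis
  \<comment> \<open>The arrows of \<open>V\<close> between the complements; the natural subtraction
    is exact at the vertices \<open>1\<close> to \<open>n\<close> by \<open>le\<close>.\<close>
  define V' where "V' = \<lparr> vdim = (\<lambda>i. vdim V i - vdim I i),
     arrow = (\<lambda>i. L (Suc i) * arrow V i * K i) \<rparr>"
  have c: "\<iota> i \<in> carrier_mat (vdim V i) (vdim I i)" "\<pi> i \<in> carrier_mat (vdim I i) (vdim V i)"
    "K i \<in> carrier_mat (vdim V i) (vdim V' i)" "L i \<in> carrier_mat (vdim V' i) (vdim V i)"
    if "1 \<le> i" "i \<le> n" for i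
    using rep_homD(1)[OF \<iota> that] rep_homD(1)[OF \<pi> that] KL[OF that]
    by (auto simp: complementary_pair_def V'_def)
  have dims: "vdim V i = vdim I i + vdim V' i" if "1 \<le> i" "i \<le> n" for i
    using le[OF that] by (simp add: V'_def)
  have V'_rep: "is_rep n V'"
    unfolding is_rep_def
  proof
    fix i assume "i \<in> {1..<n}"
    then have i: "1 \<le> i" "i \<le> n" "i < n" "1 \<le> Suc i" "Suc i \<le> n" by auto
    show "arrow V' i \<in> carrier_mat (vdim V' (Suc i)) (vdim V' i)"
      using c(3)[OF i(1,2)] c(4)[OF i(4,5)] is_repD[OF V i(1,3)] by (simp add: V'_def)
  qed
  define f where "f i = vstack (\<pi> i) (L i)" for i
  define g where "g i = hstack (\<iota> i) (K i)" for i
  have inv: "f i * g i = 1\<^sub>m (vdim V i)" "g i * f i = 1\<^sub>m (vdim V i)"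
    "\<iota> i * \<pi> i + K i * L i = 1\<^sub>m (vdim V i)" if i: "1 \<le> i" "i \<le> n" for i
    unfolding f_def g_def
    by (rule complementary_pair_inverse[OF c(1,2)[OF i] \<pi>\<iota>[OF i] le[OF i] KL[OF i]])+
  have "rep_iso n V (rep_sum I V')"
  proof (rule rep_isoI[OF V is_rep_rep_sum[OF I V'_rep], of f g])
    show "rep_hom n V (rep_sum I V') f"
    proof (rule rep_homI)
      fix i assume i: "1 \<le> i" "i < n"
      have i': "1 \<le> i" "i \<le> n" and Si: "1 \<le> Suc i" "Suc i \<le> n" using i by auto
      note ci = c[OF i'] and cS = c[OF Si] and cV = is_repD[OF V i] and cI = is_repD[OF I i]
      let ?M = "arrow V i"
      \<comment> \<open>Inserting the decomposed identity leaves only the \<open>K * L\<close> part: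
        \<open>\<iota>\<close> commutes with the arrows and \<open>L * \<iota> = 0\<close>.\<close>
      have "L (Suc i) * ?M = L (Suc i) * ?M * (\<iota> i * \<pi> i + K i * L i)"
        using inv(3)[OF i'] cS cV by simp
      also have "\<dots> = L (Suc i) * ?M * (\<iota> i * \<pi> i) + L (Suc i) * ?M * (K i * L i)"
        using ci cS cV by (intro mult_add_distrib_mat) auto
      also have "L (Suc i) * ?M * (\<iota> i * \<pi> i) = L (Suc i) * ((?M * \<iota> i) * \<pi> i)"
        using ci cS cV by (simp add: mult_assoc_dim)
      also have "\<dots> = (L (Suc i) * \<iota> (Suc i)) * (arrow I i * \<pi> i)"
        unfolding rep_homD(2)[OF \<iota> i, symmetric] using ci cS cV cI by (simp add: mult_assoc_dim)
      also have "\<dots> = 0\<^sub>m (vdim V' (Suc i)) (vdim V i)"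
        using KL[OF Si] cS ci cI by (simp add: complementary_pair_def V'_def)
      also have "L (Suc i) * ?M * (K i * L i) = arrow V' i * L i"
        using ci cS cV by (simp add: V'_def mult_assoc_dim)
      finally have LM: "L (Suc i) * ?M = arrow V' i * L i"
        using is_repD[OF V'_rep i] ci by simp
      have "f (Suc i) * ?M = vstack (\<pi> (Suc i) * ?M) (L (Suc i) * ?M)"
        unfolding f_def using cS cV by (intro vstack_mult) auto
      also have "\<dots> = block_diag (arrow I i) (arrow V' i) * f i"
        unfolding f_def rep_homD(2)[OF \<pi> i] LM
        using ci cI is_repD[OF V'_rep i] by (intro block_diag_mult_vstack[symmetric]) auto
      finally show "f (Suc i) * ?M = arrow (rep_sum I V') i * f i" by simp
    next
      fix i assume i: "1 \<le> i" "i \<le> n"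
      show "f i \<in> carrier_mat (vdim (rep_sum I V') i) (vdim V i)"
        using vstack_carrier[OF c(2,4)[OF i]] by (simp add: f_def)
    qed
  next
    fix i assume i: "1 \<le> i" "i \<le> n"
    show "g i \<in> carrier_mat (vdim V i) (vdim (rep_sum I V') i)"
      using hstack_carrier[OF c(1,3)[OF i]] by (simp add: g_def)
    show "g i * f i = 1\<^sub>m (vdim V i)" "f i * g i = 1\<^sub>m (vdim (rep_sum I V') i)"
      using inv(1,2)[OF i] dims[OF i] by simp_all
  qed
  then show ?thesis using that V'_rep dims by blast
qed

section \<open>Decomposition into intervals\<close>

lemma vdim_interval_rep [simp]: "vdim (interval_rep b d) = interval_dim b d"
  by (simp add: interval_rep_def)

lemma arrow_interval_rep:
  "arrow (interval_rep b d) i = (if b \<le> i \<and> Suc i \<le> d then 1\<^sub>m 1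
     else 0\<^sub>m (interval_dim b d (Suc i)) (interval_dim b d i))"
  by (simp add: interval_rep_def)

text \<open>Each extremal choice makes one map a morphism: maximality of \<open>d\<close> lets the
  next arrow kill the image of the chosen vector, as \<open>\<iota>\<close> requires, and minimality
  of \<open>b\<close> leaves no nonzero space before \<open>b\<close> that could obstruct
  \<open>\<pi>\<close>.\<close>

lemma interval_summand_exists:
  fixes V :: "'k::field quiver_rep"
  assumes V: "is_rep n V" and "1 \<le> j" "j \<le> n" "vdim V j > 0"
  obtains b d V' where "1 \<le> b" "b \<le> d" "d \<le> n" "is_rep n V'"
    "rep_iso n V (rep_sum (interval_rep b d) V')"
    "\<And>i. 1 \<le> i \<Longrightarrow> i \<le> n \<Longrightarrow> vdim V i = interval_dim b d i + vdim V' i"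
proof -
  define b where "b = (LEAST i. 1 \<le> i \<and> vdim V i > 0)"
  have "1 \<le> j \<and> vdim V j > 0" using assms by simp
  then have "1 \<le> b \<and> vdim V b > 0" "b \<le> j" unfolding b_def by (rule LeastI, rule Least_le)
  then have b: "1 \<le> b" "vdim V b > 0" "b \<le> n" using \<open>j \<le> n\<close> by auto
  have below: "vdim V i = 0" if "1 \<le> i" "i < b" for i
    using not_less_Least[of i "\<lambda>i. 1 \<le> i \<and> vdim V i > 0"] that unfolding b_def by auto
  define P where "P k = path_map V b k" for k
  define nz where "nz k \<longleftrightarrow> b + k \<le> n \<and> P k \<noteq> 0\<^sub>m (vdim V (b + k)) (vdim V b)" for k
  have P_carrier: "P k \<in> carrier_mat (vdim V (b + k)) (vdim V b)" if "b + k \<le> n" for k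
    unfolding P_def by (rule path_map_carrier[OF V b(1) that])
  have "nz 0"
  proof -
    have "(1\<^sub>m (vdim V b) :: 'k mat) $$ (0, 0) \<noteq> 0\<^sub>m (vdim V b) (vdim V b) $$ (0, 0)" using b by simp
    then have "(1\<^sub>m (vdim V b) :: 'k mat) \<noteq> 0\<^sub>m (vdim V b) (vdim V b)" by metis
    then show ?thesis using b unfolding nz_def P_def by simp
  qed
  define k where "k = (GREATEST k. nz k)"
  have bound: "\<And>k. nz k \<Longrightarrow> k \<le> n" by (simp add: nz_def)
  have k: "nz k" unfolding k_def by (rule GreatestI_nat[where P = nz, OF \<open>nz 0\<close> bound])
  have k_max: "k' \<le> k" if "nz k'" for k' unfolding k_def by (rule Greatest_le_nat[where P = nz, OF that bound])
  define d where "d = b + k"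
  have bd: "b \<le> d" "d \<le> n" using k by (auto simp: d_def nz_def)
  have Pk: "P k \<in> carrier_mat (vdim V d) (vdim V b)" using P_carrier bd by (simp add: d_def)
  obtain r s where rs: "r < vdim V d" "s < vdim V b" "P k $$ (r, s) \<noteq> 0"
  proof -
    have "\<exists>r s. r < vdim V d \<and> s < vdim V b \<and> P k $$ (r, s) \<noteq> 0"
    proof (rule ccontr)
      assume "\<not> ?thesis"
      then have "P k = 0\<^sub>m (vdim V d) (vdim V b)" using Pk by (intro eq_matI) auto
      with k show False by (simp add: nz_def d_def)
    qed
    then show thesis using that by blast
  qed
  define e :: "'k mat" where "e = mat_of_cols (vdim V b) [unit_vec (vdim V b) s]"
  \<comment> \<open>The coordinate functional at \<open>r\<close>, scaled so that it takes the value
    1 on \<open>P k * e\<close>.\<close>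
  define \<phi> :: "'k mat" where "\<phi> = mat_of_rows (vdim V d) [(1 / P k $$ (r, s)) \<cdot>\<^sub>v unit_vec (vdim V d) r]"
  have e: "e \<in> carrier_mat (vdim V b) 1" and \<phi>: "\<phi> \<in> carrier_mat 1 (vdim V d)"
    by (auto simp: e_def \<phi>_def)
  have col_e: "col e 0 = unit_vec (vdim V b) s" by (simp add: e_def)
  have row_\<phi>: "row \<phi> 0 = (1 / P k $$ (r, s)) \<cdot>\<^sub>v unit_vec (vdim V d) r" by (simp add: \<phi>_def)
  have \<phi>Pe: "\<phi> * (P k * e) = 1\<^sub>m 1"
  proof (rule eq_matI)
    fix i j :: nat assume "i < dim_row (1\<^sub>m 1 :: 'k mat)" "j < dim_col (1\<^sub>m 1 :: 'k mat)"
    then have ij: "i = 0" "j = 0" by auto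
    have "col (P k * e) 0 = P k *\<^sub>v unit_vec (vdim V b) s"
      unfolding col_e[symmetric] by (rule col_mult2[OF Pk e]) simp
    also have "\<dots> = col (P k) s" using Pk rs by auto
    finally have "(\<phi> * (P k * e)) $$ (0, 0) = row \<phi> 0 \<bullet> col (P k) s" using Pk e \<phi> by simp
    also have "\<dots> = 1" unfolding row_\<phi> using Pk rs by simp
    finally show "(\<phi> * (P k * e)) $$ (i, j) = (1\<^sub>m 1 :: 'k mat) $$ (i, j)" using ij by simp
  qed (use Pk e \<phi> in auto)
  \<comment> \<open>\<open>\<iota>\<close> pushes \<open>e\<close> forward from \<open>b\<close>,
    and \<open>\<pi>\<close> pulls \<open>\<phi>\<close> back from \<open>d\<close>. Outside the
    interval both are empty matrices, as its zero spaces demand.\<close>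
  define \<iota> where "\<iota> i = (if b \<le> i \<and> i \<le> d then P (i - b) * e else 0\<^sub>m (vdim V i) 0)" for i
  define \<pi> where "\<pi> i = (if b \<le> i \<and> i \<le> d then \<phi> * path_map V i (d - i) else 0\<^sub>m 0 (vdim V i))" for i
  have Q_carrier: "path_map V i (d - i) \<in> carrier_mat (vdim V d) (vdim V i)" if "b \<le> i" "i \<le> d" for i
    using path_map_carrier[OF V, of i "d - i"] that b bd by simp
  have P_carrier': "P (i - b) \<in> carrier_mat (vdim V i) (vdim V b)" if "b \<le> i" "i \<le> n" for i
    using P_carrier[of "i - b"] that by simp
  have \<iota>_carrier: "\<iota> i \<in> carrier_mat (vdim V i) (interval_dim b d i)" if "1 \<le> i" "i \<le> n" for i
    using P_carrier'[of i] that e by (auto simp: \<iota>_def interval_dim_def)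
  have \<pi>_carrier: "\<pi> i \<in> carrier_mat (interval_dim b d i) (vdim V i)" if "1 \<le> i" "i \<le> n" for i
    using Q_carrier[of i] \<phi> by (auto simp: \<pi>_def interval_dim_def)
  have \<iota>_hom: "rep_hom n (interval_rep b d) V \<iota>"
  proof (rule rep_homI)
    fix i assume i: "1 \<le> i" "i < n"
    note cV = is_repD[OF V i]
    consider (inside) "b \<le> i" "Suc i \<le> d" | (top) "i = d" | (outside) "i < b \<or> d < i"
      using bd by linarith
    then show "\<iota> (Suc i) * arrow (interval_rep b d) i = arrow V i * \<iota> i"
    proof cases
      case inside
      then have "\<iota> (Suc i) = arrow V i * P (i - b) * e"
        by (simp add: \<iota>_def P_def Suc_diff_le)
      also have "\<dots> = arrow V i * \<iota> i"
        using inside i cV e P_carrier'[of i] by (simp add: \<iota>_def mult_assoc_dim)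
      finally have "\<iota> (Suc i) = arrow V i * \<iota> i" .
      moreover have "\<iota> (Suc i) * 1\<^sub>m 1 = \<iota> (Suc i)"
        using \<iota>_carrier[of "Suc i"] inside i by (intro right_mult_one_mat') (simp add: interval_dim_def)
      ultimately show ?thesis using inside by (simp add: arrow_interval_rep)
    next
      case top
      \<comment> \<open>Here \<open>d < n\<close>, so the path map of length \<open>Suc k\<close>
        exists and must vanish by maximality of \<open>k\<close>.\<close>
      have "P (Suc k) = 0\<^sub>m (vdim V (Suc i)) (vdim V b)"
        using k_max[of "Suc k"] i top by (auto simp: nz_def d_def)
      then have "arrow V i * P k = 0\<^sub>m (vdim V (Suc i)) (vdim V b)"
        using top by (simp add: P_def d_def)
      moreover have "arrow V i * \<iota> i = (arrow V i * P k) * e"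
        using top bd cV Pk e by (simp add: \<iota>_def mult_assoc_dim d_def)
      ultimately show ?thesis
        using top bd e by (simp add: arrow_interval_rep interval_dim_def \<iota>_def)
    next
      case outside
      then show ?thesis
        using \<iota>_carrier[of i] \<iota>_carrier[of "Suc i"] i cV
        by (intro eq_matI) (auto simp: arrow_interval_rep interval_dim_def)
    qed
  qed (simp add: \<iota>_carrier)
  have \<pi>_hom: "rep_hom n V (interval_rep b d) \<pi>"
  proof (rule rep_homI)
    fix i assume i: "1 \<le> i" "i < n"
    note cV = is_repD[OF V i]
    consider (inside) "b \<le> i" "Suc i \<le> d" | (bottom) "i < b" | (above) "d < Suc i"
      using bd by linarith
    then show "\<pi> (Suc i) * arrow V i = arrow (interval_rep b d) i * \<pi> i"
    proof cases
      case inside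
      have "path_map V (i + 1) (d - Suc i) * path_map V i 1 = path_map V i (1 + (d - Suc i))"
        using inside i bd by (intro path_map_comp[OF V]) auto
      moreover have "1 + (d - Suc i) = d - i" "path_map V i 1 = arrow V i" using inside cV by auto
      ultimately have "path_map V (Suc i) (d - Suc i) * arrow V i = path_map V i (d - i)"
        by (simp only: Suc_eq_plus1)
      then have "\<pi> (Suc i) * arrow V i = \<pi> i"
        using inside cV \<phi> Q_carrier[of "Suc i"] by (simp add: \<pi>_def mult_assoc_dim)
      then show ?thesis
        using inside \<pi>_carrier[of i] i by (simp add: arrow_interval_rep interval_dim_def)
    next
      case bottom
      then have "vdim V i = 0" using below i by simp
      then show ?thesis
        using \<pi>_carrier[of i] \<pi>_carrier[of "Suc i"] i cV bottom
        by (intro eq_matI) (auto simp: arrow_interval_rep interval_dim_def)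
    next
      case above
      then show ?thesis
        using \<pi>_carrier[of i] \<pi>_carrier[of "Suc i"] i cV
        by (intro eq_matI) (auto simp: arrow_interval_rep interval_dim_def)
    qed
  qed (simp add: \<pi>_carrier)
  have "\<pi> i * \<iota> i = 1\<^sub>m (vdim (interval_rep b d :: 'k quiver_rep) i)" if i: "1 \<le> i" "i \<le> n" for i
  proof (cases "b \<le> i \<and> i \<le> d")
    case True
    \<comment> \<open>At every vertex of the interval the composite is
      \<open>\<phi> * (P k * e)\<close>, because the paths through \<open>i\<close> concatenate to
      the one from \<open>b\<close> to \<open>d\<close>.\<close>
    have "path_map V (b + (i - b)) (d - i) * path_map V b (i - b) = path_map V b (i - b + (d - i))"
      using True i bd b by (intro path_map_comp[OF V]) auto
    then have "path_map V i (d - i) * P (i - b) = P k" using True by (simp add: P_def d_def)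
    moreover have "\<pi> i * \<iota> i = \<phi> * ((path_map V i (d - i) * P (i - b)) * e)"
      using True i \<phi> e Q_carrier[of i] P_carrier'[of i] by (simp add: \<pi>_def \<iota>_def mult_assoc_dim)
    ultimately show ?thesis using \<phi>Pe True by (simp add: interval_dim_def)
  next
    case False
    then show ?thesis by (intro eq_matI) (auto simp: \<pi>_def \<iota>_def interval_dim_def)
  qed
  then obtain V' where "is_rep n V'" "rep_iso n V (rep_sum (interval_rep b d) V')"
    "\<And>i. 1 \<le> i \<Longrightarrow> i \<le> n \<Longrightarrow> vdim V i = vdim (interval_rep b d :: 'k quiver_rep) i + vdim V' i"
    using split_off_summand[OF V is_rep_interval_rep \<iota>_hom \<pi>_hom]
    by (metis One_nat_def interval_dim_def le_numeral_extra(3,4) vdim_interval_rep zero_le_one)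
  then show ?thesis using that[of b d V'] b bd by simp
qed

lemma interval_decomposition_exists:
  fixes V :: "'k::field quiver_rep"
  assumes "is_rep n V"
  shows "\<exists>Ls. set Ls \<subseteq> interval_reps n \<and> rep_iso n V (direct_sum_rep Ls)"
  using assms
proof (induction "\<Sum>i=1..n. vdim V i" arbitrary: V rule: less_induct)
  case less
  show ?case
  proof (cases "\<exists>j. 1 \<le> j \<and> j \<le> n \<and> vdim V j > 0")
    case True
    then obtain b d V' where bd: "1 \<le> b" "b \<le> d" "d \<le> n" and V': "is_rep n V'"
      and iso: "rep_iso n V (rep_sum (interval_rep b d) V')"
      and dims: "\<And>i. 1 \<le> i \<Longrightarrow> i \<le> n \<Longrightarrow> vdim V i = interval_dim b d i + vdim V' i"
      using interval_summand_exists[OF less.prems] by blast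
    have "(\<Sum>i=1..n. vdim V' i) < (\<Sum>i=1..n. vdim V i)"
    proof (rule sum_strict_mono_ex1)
      \<comment> \<open>The dimension drops strictly at the vertex \<open>b\<close> of the interval
        split off.\<close>
      show "\<exists>i\<in>{1..n}. vdim V' i < vdim V i"
        using dims[of b] bd by (intro bexI[of _ b]) (auto simp: interval_dim_def)
    qed (use dims in auto)
    then obtain Ls where Ls: "set Ls \<subseteq> interval_reps n" "rep_iso n V' (direct_sum_rep Ls)"
      using less.hyps V' by blast
    have D: "is_rep n (direct_sum_rep Ls)"
      using Ls(1) by (intro is_rep_direct_sum_rep) (auto simp: interval_reps_def is_rep_interval_rep)
    let ?I = "interval_rep b d :: 'k quiver_rep"
    have I: "is_rep n ?I" by (rule is_rep_interval_rep)
    have "rep_iso n (rep_sum ?I V') (direct_sum_rep (?I # Ls))"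
      unfolding direct_sum_rep_Cons
      by (intro rep_iso_rep_sum_cong I V' D rep_iso_refl Ls)
    then have "rep_iso n V (direct_sum_rep (?I # Ls))"
      using rep_iso_trans[OF less.prems _ _ iso] I V' D
      by (simp add: direct_sum_rep_Cons is_rep_rep_sum)
    moreover have "set (?I # Ls) \<subseteq> interval_reps n"
      using Ls bd by (auto simp: interval_reps_def)
    ultimately show ?thesis by blast
  next
    case False
    then have z: "vdim V i = 0" if "1 \<le> i" "i \<le> n" for i using that by auto
    have one: "1\<^sub>m 0 = (0\<^sub>m 0 0 :: 'k mat)" by (rule eq_matI) auto
    have D: "is_rep n (direct_sum_rep [] :: 'k quiver_rep)" by (rule is_rep_direct_sum_rep) simp
    have "rep_iso n V (direct_sum_rep [])"
    proof (rule rep_isoI[OF less.prems D, of "\<lambda>_. 0\<^sub>m 0 0" "\<lambda>_. 0\<^sub>m 0 0"])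
      show "rep_hom n V (direct_sum_rep []) (\<lambda>_. 0\<^sub>m 0 0)"
      proof (rule rep_homI)
        fix i assume i: "1 \<le> i" "i < n"
        show "0\<^sub>m 0 0 * arrow V i = arrow (direct_sum_rep []) i * 0\<^sub>m 0 0"
          using is_repD[OF less.prems i] is_repD[OF D i] i z by (intro eq_matI) auto
      qed (simp add: z)
    qed (use one in \<open>simp_all add: z\<close>)
    then show ?thesis by (intro exI[of _ "[]"]) simp
  qed
qed

section \<open>Multiplicities\<close>

definition intervals :: "nat \<Rightarrow> (nat \<times> nat) set" where
  "intervals n = (SIGMA b:{1..n}. {b..n})"

lemma finite_intervals [simp]: "finite (intervals n)"
  by (simp add: intervals_def)

lemma mem_intervals [simp]: "(b, d) \<in> intervals n \<longleftrightarrow> 1 \<le> b \<and> b \<le> d \<and> d \<le> n"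
  by (auto simp: intervals_def)

text \<open>The dimension vector is the indicator of a nonempty interval and so determines both
  endpoints. Sums over pairs of endpoints therefore count each record once.\<close>

lemma interval_rep_eq_iff:
  assumes "b \<le> d" "b' \<le> d'"
  shows "(interval_rep b d :: 'k::field quiver_rep) = interval_rep b' d' \<longleftrightarrow> b = b' \<and> d = d'"
proof
  assume "(interval_rep b d :: 'k quiver_rep) = interval_rep b' d'"
  then have "interval_dim b d i = interval_dim b' d' i" for i
    by (metis vdim_interval_rep)
  then have eq: "b \<le> i \<and> i \<le> d \<longleftrightarrow> b' \<le> i \<and> i \<le> d'" for i
    unfolding interval_dim_def by (metis zero_neq_one)
  have "b' \<le> b" "d \<le> d'" using eq[of b] eq[of d] assms by blast+
  moreover have "b \<le> b'" "d' \<le> d" using eq[of b'] eq[of d'] assms by blast+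
  ultimately show "b = b' \<and> d = d'" by simp
qed simp

definition interval_list :: "nat \<Rightarrow> ('k::field quiver_rep \<Rightarrow> nat) \<Rightarrow> 'k quiver_rep list" where
  "interval_list n m = concat [replicate (m (interval_rep b d)) (interval_rep b d).
     b \<leftarrow> [1..<Suc n], d \<leftarrow> [b..<Suc n]]"

lemma interval_sum_eq: "interval_sum n m = direct_sum_rep (interval_list n m)"
  by (simp add: interval_sum_def interval_list_def)

lemma interval_rep_in_interval_reps:
  "1 \<le> b \<Longrightarrow> b \<le> d \<Longrightarrow> d \<le> n \<Longrightarrow> interval_rep b d \<in> interval_reps n"
  unfolding interval_reps_def by blast

lemma set_interval_list: "set (interval_list n m) \<subseteq> interval_reps n"
  by (auto simp: interval_list_def intro!: interval_rep_in_interval_reps)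

lemma is_rep_interval_reps: "L \<in> interval_reps n \<Longrightarrow> is_rep k L"
  by (auto simp: interval_reps_def is_rep_interval_rep)

lemma is_rep_interval_sum: "is_rep k (interval_sum n m)"
  unfolding interval_sum_eq
  using set_interval_list is_rep_interval_reps by (intro is_rep_direct_sum_rep) blast

lemma sum_list_concat_map: "sum_list (concat xss) = sum_list (map sum_list xss)"
  by (induction xss) auto

text \<open>Used twice: with \<open>h\<close> an indicator it counts occurrences of a summand, and
  with \<open>h\<close> a product of dimensions it adds up ranks.\<close>

lemma sum_list_interval_list:
  fixes h :: "'k::field quiver_rep \<Rightarrow> nat"
  shows "(\<Sum>L\<leftarrow>interval_list n m. h L) =
    (\<Sum>(b, d)\<in>intervals n. m (interval_rep b d) * h (interval_rep b d))"
proof -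
  have "(\<Sum>L\<leftarrow>interval_list n m. h L) =
      (\<Sum>b\<leftarrow>[1..<Suc n]. \<Sum>d\<leftarrow>[b..<Suc n]. m (interval_rep b d) * h (interval_rep b d))"
    unfolding interval_list_def
    by (simp add: map_concat sum_list_concat_map o_def sum_list_replicate del: upt_Suc)
  also have "\<dots> = (\<Sum>b=1..n. \<Sum>d=b..n. m (interval_rep b d) * h (interval_rep b d))"
    by (simp add: interv_sum_list_conv_sum_set_nat atLeastLessThanSuc_atLeastAtMost del: upt_Suc)
  also have "\<dots> = (\<Sum>(b, d)\<in>intervals n. m (interval_rep b d) * h (interval_rep b d))"
    unfolding intervals_def by (rule sum.Sigma) auto
  finally show ?thesis .
qed

lemma sum_intervals_delta:
  assumes "(b, d) \<in> intervals n"
  shows "(\<Sum>(b', d')\<in>intervals n. (h b' d' :: nat) * (if b' = b \<and> d' = d then 1 else 0)) = h b d"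
proof -
  have "(\<Sum>(b', d')\<in>intervals n. h b' d' * (if b' = b \<and> d' = d then 1 else 0)) =
      (\<Sum>p\<in>intervals n. if p = (b, d) then h b d else 0)"
    by (intro sum.cong) (auto split: if_splits)
  then show ?thesis using assms by (simp add: sum.delta)
qed

text \<open>On \<open>interval_reps n\<close> a single pair of endpoints contributes; elsewhere both
  sides vanish by the normalisation of \<open>m\<close>.\<close>

lemma count_interval_list:
  fixes m :: "'k::field quiver_rep \<Rightarrow> nat"
  assumes m: "\<And>L. L \<notin> interval_reps n \<Longrightarrow> m L = 0"
  shows "count (mset (interval_list n m)) L = m L"
proof (cases "L \<in> interval_reps n")
  case True
  then obtain b d where bd: "1 \<le> b" "b \<le> d" "d \<le> n" and L: "L = interval_rep b d"
    by (auto simp: interval_reps_def)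
  have "count (mset Ls) L = (\<Sum>X\<leftarrow>Ls. if X = L then 1 else 0)" for Ls
    by (induction Ls) auto
  then have "count (mset (interval_list n m)) L =
      (\<Sum>(b', d')\<in>intervals n. m (interval_rep b' d') * (if interval_rep b' d' = L then 1 else 0))"
    by (simp only: sum_list_interval_list)
  also have "\<dots> = (\<Sum>(b', d')\<in>intervals n. m (interval_rep b' d') * (if b' = b \<and> d' = d then 1 else 0))"
    using bd by (intro sum.cong) (auto simp: L interval_rep_eq_iff)
  also have "\<dots> = m L" unfolding L by (rule sum_intervals_delta) (use bd in simp)
  finally show ?thesis .
next
  case False
  then have "L \<notin> set (interval_list n m)" using set_interval_list by blast
  then show ?thesis using m[OF False] by (simp add: not_in_iff[symmetric])
qed

text \<open>Take \<open>m\<close> to count occurrences in a decomposing list;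
  \<open>interval_list n m\<close> is then a rearrangement of that list.\<close>

lemma interval_multiplicities_exist:
  fixes V :: "'k::field quiver_rep"
  assumes V: "is_rep n V"
  shows "\<exists>m. (\<forall>L. L \<notin> interval_reps n \<longrightarrow> m L = 0) \<and> rep_iso n V (interval_sum n m)"
proof -
  obtain Ls where Ls: "set Ls \<subseteq> interval_reps n" and iso: "rep_iso n V (direct_sum_rep Ls)"
    using interval_decomposition_exists[OF V] by blast
  define m where "m = count (mset Ls)"
  have m: "m L = 0" if "L \<notin> interval_reps n" for L
    using that Ls unfolding m_def by (metis count_mset_0_iff subsetD)
  have "mset Ls = mset (interval_list n m)"
    by (rule multiset_eqI) (metis count_interval_list m m_def)
  moreover have rep: "\<forall>X\<in>set Ls. is_rep n X" using Ls is_rep_interval_reps by blast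
  ultimately have "rep_iso n (direct_sum_rep Ls) (interval_sum n m)"
    unfolding interval_sum_eq by (rule rep_iso_direct_sum_rep_perm)
  then have "rep_iso n V (interval_sum n m)"
    using rep_iso_trans[OF V is_rep_direct_sum_rep[OF rep] is_rep_interval_sum iso] by blast
  then show ?thesis using m by blast
qed

section \<open>Ranks of path maps as numbers of summands containing both end vertices\<close>

definition path_rank :: "nat \<Rightarrow> ('k::field quiver_rep \<Rightarrow> nat) \<Rightarrow> nat \<Rightarrow> nat \<Rightarrow> nat" where
  "path_rank n m i e =
     (\<Sum>(b, d)\<in>intervals n. m (interval_rep b d) * (interval_dim b d i * interval_dim b d e))"

text \<open>No interval reaches the fictitious vertices \<open>0\<close> and \<open>Suc n\<close>;
  this and the next lemma are the counterparts of the zero maps \<open>M 0\<close> and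
  \<open>M n\<close>.\<close>

lemma path_rank_0 [simp]: "path_rank n m 0 e = 0"
  unfolding path_rank_def by (rule sum.neutral) (auto simp: interval_dim_def)

lemma path_rank_Suc_n [simp]: "path_rank n m i (Suc n) = 0"
  unfolding path_rank_def by (rule sum.neutral) (auto simp: interval_dim_def)

text \<open>An interval containing \<open>b\<close> and \<open>d\<close> equals \<open>[b,d]\<close>
  iff it contains neither \<open>b - 1\<close> nor \<open>Suc d\<close>. This gives an identity of
  indicators for each interval, which is weighted by \<open>m\<close> and summed; moving the
  negative terms across avoids natural subtraction.\<close>

lemma path_rank_inclusion_exclusion:
  assumes "1 \<le> b" "b \<le> d" "d \<le> n"
  shows "m (interval_rep b d) + path_rank n m (b - 1) d + path_rank n m b (Suc d) =
    path_rank n m (b - 1) (Suc d) + path_rank n m b d"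
proof -
  let ?\<chi> = "\<lambda>p. interval_dim (fst p) (snd p)" and ?m = "\<lambda>p. m (interval_rep (fst p) (snd p))"
  let ?\<delta> = "\<lambda>p. if fst p = b \<and> snd p = d then 1 else 0 :: nat"
  have eq: "?\<delta> p + ?\<chi> p (b - 1) * ?\<chi> p d + ?\<chi> p b * ?\<chi> p (Suc d) =
      ?\<chi> p (b - 1) * ?\<chi> p (Suc d) + ?\<chi> p b * ?\<chi> p d" if "p \<in> intervals n" for p
    using that assms by (cases p) (simp add: interval_dim_def, linarith)
  have "(\<Sum>p\<in>intervals n. ?m p * ?\<delta> p) = m (interval_rep b d)"
    using sum_intervals_delta[of b d n "\<lambda>b d. m (interval_rep b d)"] assms by (simp add: split_def)
  moreover have "(\<Sum>p\<in>intervals n. ?m p * (?\<delta> p + ?\<chi> p (b - 1) * ?\<chi> p d + ?\<chi> p b * ?\<chi> p (Suc d))) =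
      (\<Sum>p\<in>intervals n. ?m p * (?\<chi> p (b - 1) * ?\<chi> p (Suc d) + ?\<chi> p b * ?\<chi> p d))"
    using eq by (intro sum.cong refl) (simp only:)
  ultimately show ?thesis
    unfolding path_rank_def split_def distrib_left sum.distrib by simp
qed

text \<open>Ranks are invariant under isomorphism and add over summands, and each interval
  contributes 1 or 0.\<close>

lemma has_rank_factor_path_rank:
  fixes V :: "'k::field quiver_rep"
  assumes V: "is_rep n V" and iso: "rep_iso n V (interval_sum n m)"
    and i: "1 \<le> i" and k: "i + k \<le> n"
  shows "has_rank_factor (path_map V i k) (path_rank n m i (i + k))"
proof -
  have "has_rank_factor (path_map (interval_sum n m) i k)
      (\<Sum>L\<leftarrow>interval_list n m. vdim L i * vdim L (i + k))"
    unfolding interval_sum_eq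
  proof (rule has_rank_factor_path_map_direct_sum[OF _ i k])
    show "\<forall>L\<in>set (interval_list n m). is_rep n L"
      using set_interval_list is_rep_interval_reps by blast
    show "\<forall>L\<in>set (interval_list n m). has_rank_factor (path_map L i k) (vdim L i * vdim L (i + k))"
    proof
      fix L assume "L \<in> set (interval_list n m)"
      then obtain b d where "L = interval_rep b d"
        using set_interval_list[of n m] by (auto simp: interval_reps_def)
      then show "has_rank_factor (path_map L i k) (vdim L i * vdim L (i + k))"
        using has_rank_factor_path_map_interval_rep by simp
    qed
  qed
  then show ?thesis
    unfolding sum_list_interval_list path_rank_def
    by (intro has_rank_factor_path_map_iso[OF V is_rep_interval_sum iso i k]) simp
qed

lemma mat_rank_zero [simp]: "mat_rank (0\<^sub>m r c) = 0"
  by (rule mat_rank_eqI[OF has_rank_factor_zero])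

section \<open>From products of matrices to the multiplicity formula\<close>

context
  fixes n :: nat and a :: "nat \<Rightarrow> nat" and M :: "nat \<Rightarrow> 'k::field mat"
  assumes rep: "is_rep n \<lparr> vdim = a, arrow = M \<rparr>"
    and M0: "M 0 = 0\<^sub>m (a 1) (a 0)" and Mn: "M n = 0\<^sub>m (a (Suc n)) (a n)"
begin

text \<open>The boundary matrices have shapes that fit at both ends, so products may run over all
  indices from \<open>0\<close> to \<open>n\<close>.\<close>

lemma arrow_carrier: "i \<le> n \<Longrightarrow> M i \<in> carrier_mat (a (Suc i)) (a i)"
  using is_repD[OF rep, of i] M0 Mn by (cases "i = 0 \<or> i = n") auto

lemma composite_carrier:
  "i \<le> j \<Longrightarrow> j \<le> n \<Longrightarrow> composite M j i \<in> carrier_mat (a (Suc j)) (a i)"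
proof (induction j)
  case (Suc j)
  then show ?case using arrow_carrier[of "Suc j"] by (cases "i \<le> j") (auto simp: le_Suc_eq)
qed (use arrow_carrier[of 0] in simp)

lemma composite_self: "composite M i i = M i"
  by (cases i) auto

text \<open>The product over the arrows \<open>i\<close> to \<open>i + k\<close> has
  \<open>k + 1\<close> factors, so the path ends at vertex \<open>i + k + 1\<close>.\<close>

lemma composite_eq_path_map:
  assumes "1 \<le> i" "i + k < n"
  shows "composite M (i + k) i = path_map \<lparr> vdim = a, arrow = M \<rparr> i (Suc k)"
  using assms
proof (induction k)
  case 0
  then show ?case using arrow_carrier[of i] by (simp add: composite_self)
next
  case (Suc k)
  then show ?case by simp
qed

lemma composite_from_0: "j \<le> n \<Longrightarrow> composite M j 0 = 0\<^sub>m (a (Suc j)) (a 0)"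
proof (induction j)
  case (Suc j)
  then show ?case using arrow_carrier[of "Suc j"] by simp
qed (simp add: M0)

lemma composite_to_n:
  assumes "i \<le> n"
  shows "composite M n i = 0\<^sub>m (a (Suc n)) (a i)"
proof (cases "i = n")
  case True
  then show ?thesis by (simp add: composite_self Mn)
next
  case False
  then obtain n' where n': "n = Suc n'" "i \<le> n'" using assms by (cases n) auto
  then show ?thesis using Mn composite_carrier[of i n'] by simp
qed

text \<open>The last arrow \<open>j\<close> ends at vertex \<open>Suc j\<close>. If
  \<open>M 0\<close> or \<open>M n\<close> occurs, both sides are zero, so one formula covers
  interior and boundary.\<close>

lemma mat_rank_composite:
  assumes iso: "rep_iso n \<lparr> vdim = a, arrow = M \<rparr> (interval_sum n m)" and "i \<le> j" "j \<le> n"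
  shows "mat_rank (composite M j i) = path_rank n m i (Suc j)"
proof -
  consider "i = 0" | "j = n" | "1 \<le> i" "j < n" using assms by linarith
  then show ?thesis
  proof cases
    case 1
    then show ?thesis using composite_from_0 assms by simp
  next
    case 2
    then show ?thesis using composite_to_n assms by simp
  next
    case 3
    have "composite M j i = path_map \<lparr> vdim = a, arrow = M \<rparr> i (Suc (j - i))"
      using composite_eq_path_map[of i "j - i"] 3 assms by simp
    then show ?thesis
      using mat_rank_eqI[OF has_rank_factor_path_rank[OF rep iso, of i "Suc (j - i)"]] 3 assms by simp
  qed
qed

text \<open>The trivial path at \<open>b\<close> is an identity matrix, whose rank is
  \<open>a b\<close>.\<close>

lemma vdim_eq_path_rank:
  assumes iso: "rep_iso n \<lparr> vdim = a, arrow = M \<rparr> (interval_sum n m)" and "1 \<le> b" "b \<le> n"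
  shows "a b = path_rank n m b b"
  using mat_rank_eqI[OF has_rank_factor_path_rank[OF rep iso, of b 0]]
    mat_rank_eqI[OF has_rank_factor_one, of "a b", where ?'a = 'k] assms by simp

text \<open>Proved for every \<open>m\<close> that realises the representation, so that uniqueness
  of multiplicities follows as well: the right-hand side does not mention \<open>m\<close>.\<close>

lemma interval_multiplicity_formula:
  assumes iso: "rep_iso n \<lparr> vdim = a, arrow = M \<rparr> (interval_sum n m)"
    and bd: "1 \<le> b" "b \<le> d" "d \<le> n"
  shows "int (m (interval_rep b d)) =
    (if b < d
     then int (mat_rank (composite M d (b - 1))) + int (mat_rank (composite M (d - 1) b))
          - int (mat_rank (composite M (d - 1) (b - 1))) - int (mat_rank (composite M d b))
     else int (mat_rank (M d * M (d - 1))) + int (a b)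
          - int (mat_rank (M (d - 1))) - int (mat_rank (M d)))"
proof (cases "b < d")
  case True
  then show ?thesis
    using path_rank_inclusion_exclusion[OF bd, of m] bd
      mat_rank_composite[OF iso, of "b - 1" d] mat_rank_composite[OF iso, of b "d - 1"]
      mat_rank_composite[OF iso, of "b - 1" "d - 1"] mat_rank_composite[OF iso, of b d]
    by simp
next
  case False
  then have [simp]: "b = d" using bd by simp
  \<comment> \<open>For \<open>b = d\<close> the product from \<open>b\<close> to
    \<open>d - 1\<close> is empty and stands for an identity, which \<open>composite\<close> cannot
    express; \<open>a b\<close> supplies its rank.\<close>
  have "composite M d (d - 1) = M d * M (d - 1)"
    using bd composite_self[of "d - 1"] by (cases d) auto
  then show ?thesis
    using path_rank_inclusion_exclusion[OF bd, of m] bd vdim_eq_path_rank[OF iso, of d]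
      mat_rank_composite[OF iso, of "d - 1" d] mat_rank_composite[OF iso, of "d - 1" "d - 1"]
      mat_rank_composite[OF iso, of d d]
    by (simp add: composite_self)
qed

text \<open>The description by \<open>THE\<close> is justified by existence from the decomposition
  and by uniqueness from the rank formula, with the value \<open>0\<close> prescribed off
  \<open>interval_reps n\<close>.\<close>

lemma multiplicity_fun_iso:
  "rep_iso n \<lparr> vdim = a, arrow = M \<rparr>
     (interval_sum n (multiplicity_fun n \<lparr> vdim = a, arrow = M \<rparr>))"
proof -
  let ?V = "\<lparr> vdim = a, arrow = M \<rparr>"
  let ?P = "\<lambda>m. (\<forall>L. L \<notin> interval_reps n \<longrightarrow> m L = 0) \<and> rep_iso n ?V (interval_sum n m)"
  have ex1: "\<exists>!m. ?P m"
  proof (rule ex_ex1I)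
    show "\<exists>m. ?P m" by (rule interval_multiplicities_exist[OF rep])
  next
    fix m m' assume m: "?P m" and m': "?P m'"
    show "m = m'"
    proof
      fix L
      show "m L = m' L"
      proof (cases "L \<in> interval_reps n")
        case True
        then obtain b d where bd: "1 \<le> b" "b \<le> d" "d \<le> n" and L: "L = interval_rep b d"
          by (auto simp: interval_reps_def)
        have "int (m L) = int (m' L)"
          unfolding L
          by (simp only: interval_multiplicity_formula[OF conjunct2[OF m] bd]
              interval_multiplicity_formula[OF conjunct2[OF m'] bd])
        then show ?thesis by simp
      qed (use m m' in simp)
    qed
  qed
  show ?thesis
    unfolding multiplicity_fun_def by (rule conjunct2[OF theI'[OF ex1]])
qed

end

theorem mainTheorem6:
  fixes n :: nat and a :: "nat \<Rightarrow> nat" and M :: "nat \<Rightarrow> 'k::alg_closed_field mat"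
  assumes "n \<ge> 1"
    and "is_rep n \<lparr> vdim = a, arrow = M \<rparr>"
    and "M 0 = 0\<^sub>m (a 1) (a 0)"
    and "M n = 0\<^sub>m (a (Suc n)) (a n)"
    and "1 \<le> b" and "b \<le> d" and "d \<le> n"
  shows "int (multiplicity_fun n \<lparr> vdim = a, arrow = M \<rparr> (interval_rep b d)) =
    (if b < d
     then int (mat_rank (composite M d (b - 1))) + int (mat_rank (composite M (d - 1) b))
          - int (mat_rank (composite M (d - 1) (b - 1))) - int (mat_rank (composite M d b))
     else int (mat_rank (M d * M (d - 1))) + int (a b)
          - int (mat_rank (M (d - 1))) - int (mat_rank (M d)))"
  by (rule interval_multiplicity_formula[OF assms(2-4) multiplicity_fun_iso[OF assms(2-4)] assms(5-7)])

end
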